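(* Let $K$ be a perfect field, let $P=K[x_1,\dots,x_n]$, and let $I$ be a zero-dimensional ideal in $P$. Consider the following procedure. 1. Let $J=I$ and compute $d=\dim_K(P/J)$. 2. First Loop: for $i=1,\dots,n$ do: 2.1. compute $\mu=\mu_{x_i,J}$; 2.2. factorize $\mu$; 2.3. if $\mu$ is not a power of an irreducible factor, return false; 2.4. if $\deg(\mu)=d$ then return true; 2.5. if $\mu$ is not square-free then: (2.5.1) let $\mu=\mathrm{sqfree}(\mu)$; (2.5.2) let $J=J+\langle\mu(x_i)\rangle$; (2.5.3) compute $d=\dim_K(P/J)$; (2.5.4) if $\deg(\mu)=d$ then return true. 3. If $K$ is finite, with $q=\#K$: compute $s=\dim_K(\mathrm{Frob}_q(P/I))$; if $s=1$ return true, else return false. 4. (Otherwise $K$ is infinite.) Second Loop: repeat: 4.1. pick a random linear form $\ell\in P$; 4.2. compute $\mu=\mu_{\ell,J}$; 4.3. if $\mu$ is reducible return false; 4.4. if $\deg(\mu)=d$ then return true. Then, whatever linear forms are picked in the Second Loop, whenever the procedure returns an answer this answer is true if $I$ is a primary ideal and false if $I$ is not a primary ideal. If $K$ is finite, the procedure always terminates.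
   Context: An ideal $I$ of $P$ is zero-dimensional if $P/I$ is non-zero and finite-dimensional over $K$. For $f\in P$ and a zero-dimensional ideal $J$, the minimal polynomial $\mu_{f,J}(z)\in K[z]$ is the monic generator of the kernel of the $K$-algebra homomorphism $K[z]\to P/J$, $z\mapsto f\bmod J$. For a polynomial $g$ of positive degree, $\mathrm{sqfree}(g)$ is the product of all distinct irreducible factors of $g$ (up to a constant factor). If $K$ is a finite field with $q$ elements and $R=P/I$ is a zero-dimensional $K$-algebra, the map $\Phi_q:R\to R$, $a\mapsto a^q$, is a $K$-linear endomorphism, and the $q$-Frobenius space of $R$ is its fixed-point space $\mathrm{Frob}_q(R)=\{a\in R: a^q-a=0\}$, a $K$-vector subspace of $R$. The basic operations in the procedure are assumed to be computable. *)

theory Defs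
  imports
    "HOL-Algebra.Embedded_Algebras"
    "HOL-Library.Poly_Mapping"
    "HOL-Computational_Algebra.Polynomial"
    "HOL-Computational_Algebra.Squarefree"
begin

definition perfect_field :: "'k::field itself \<Rightarrow> bool" where
  "perfect_field _ \<longleftrightarrow> CHAR('k) = 0 \<or> (\<forall>a::'k. \<exists>b. b ^ CHAR('k) = a)"


section \<open>The polynomial ring in \<open>n\<close> indeterminates\<close>

text \<open>
  A monomial is its finitely supported exponent function, a polynomial is a finitely supported
  function from monomials to coefficients. The indeterminates are numbered \<open>1, \<dots>, n\<close>, and the
  ring in \<open>n\<close> indeterminates is the subring of those polynomials that involve no others.
  Univariate polynomials are those of \<^typ>\<open>'k poly\<close>.
\<close>

type_synonym 'k mpoly = "(nat \<Rightarrow>\<^sub>0 nat) \<Rightarrow>\<^sub>0 'k"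

definition mconst :: "'k \<Rightarrow> 'k::field mpoly" where
  "mconst c = Poly_Mapping.single 0 c"

definition mvar :: "nat \<Rightarrow> 'k::field mpoly" where
  "mvar i = Poly_Mapping.single (Poly_Mapping.single i 1) 1"

definition mpoly_ring :: "nat \<Rightarrow> 'k::field mpoly ring" where
  "mpoly_ring n =
     \<lparr>carrier = {p. \<forall>m\<in>Poly_Mapping.keys p. Poly_Mapping.keys m \<subseteq> {1..n}},
      monoid.mult = (*), one = 1, zero = 0, add = (+)\<rparr>"

definition linear_form :: "nat \<Rightarrow> 'k::field mpoly \<Rightarrow> bool" where
  "linear_form n l \<longleftrightarrow> (\<exists>c :: nat \<Rightarrow> 'k. l = (\<Sum>i=1..n. mconst (c i) * mvar i))"

text \<open>\<open>subst_poly g f\<close> is \<open>g(f)\<close>.\<close>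

definition subst_poly :: "'k poly \<Rightarrow> 'k mpoly \<Rightarrow> 'k::field mpoly" where
  "subst_poly g f = poly (map_poly mconst g) f"

lemma cring_mpoly_ring: "cring (mpoly_ring n :: 'k::field mpoly ring)"
proof -
  define C where "C = carrier (mpoly_ring n :: 'k mpoly ring)"
  have C: "p \<in> C \<longleftrightarrow> (\<forall>m\<in>Poly_Mapping.keys p. Poly_Mapping.keys m \<subseteq> {1..n})" for p
    by (simp add: C_def mpoly_ring_def)
  have mult_C: "p * q \<in> C" if "p \<in> C" "q \<in> C" for p q
    unfolding C
  proof
    fix m assume "m \<in> Poly_Mapping.keys (p * q)"
    then obtain a b where m: "m = a + b" and "a \<in> Poly_Mapping.keys p" "b \<in> Poly_Mapping.keys q"
      using keys_mult[of p q] by blast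
    with that C have "Poly_Mapping.keys a \<subseteq> {1..n}" "Poly_Mapping.keys b \<subseteq> {1..n}"
      by blast+
    then show "Poly_Mapping.keys m \<subseteq> {1..n}"
      unfolding m using Poly_Mapping.keys_add[of a b] by blast
  qed
  have add_C: "p + q \<in> C" if "p \<in> C" "q \<in> C" for p q
    using that Poly_Mapping.keys_add[of p q] unfolding C by blast
  have neg_C: "- p \<in> C" if "p \<in> C" for p
    using that unfolding C by simp
  have zero_C: "0 \<in> C" and one_C: "1 \<in> C"
    unfolding C by simp_all
  have R: "mpoly_ring n =
      \<lparr>carrier = C, monoid.mult = (*), one = 1, zero = 0, add = (+)\<rparr>"
    by (simp add: C_def mpoly_ring_def)
  have inv_C: "\<exists>q\<in>C. p + q = 0" if "p \<in> C" for p
    using neg_C[OF that] by (intro bexI[of _ "- p"]) simp_all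
  show ?thesis
    unfolding R
  proof (rule cringI)
    show "abelian_group \<lparr>carrier = C, monoid.mult = (*), one = 1, zero = 0, add = (+)\<rparr>"
      by (rule abelian_groupI) (simp_all add: add_C zero_C inv_C ac_simps)
    show "Group.comm_monoid \<lparr>carrier = C, monoid.mult = (*), one = 1, zero = 0, add = (+)\<rparr>"
      by (rule comm_monoidI) (simp_all add: mult_C one_C ac_simps)
  qed (simp add: distrib_right)
qed


section \<open>Zero-dimensional and primary ideals\<close>

definition primary_ideal :: "'a set \<Rightarrow> ('a, 'b) ring_scheme \<Rightarrow> bool" where
  "primary_ideal I R \<longleftrightarrow> ideal I R \<and> I \<noteq> carrier R \<and>
     (\<forall>a\<in>carrier R. \<forall>b\<in>carrier R. a \<otimes>\<^bsub>R\<^esub> b \<in> I \<longrightarrow>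
        a \<in> I \<or> (\<exists>m::nat. m > 0 \<and> b [^]\<^bsub>R\<^esub> m \<in> I))"

text \<open>The image of \<open>K\<close> in \<open>P/J\<close>; for proper \<open>J\<close> it is a subfield isomorphic to \<open>K\<close>, over which
  the library notion of dimension is taken.\<close>

definition scalars_mod :: "nat \<Rightarrow> 'k::field mpoly set \<Rightarrow> 'k mpoly set set" where
  "scalars_mod n J = range (\<lambda>c. J +>\<^bsub>mpoly_ring n\<^esub> mconst c)"

definition dim_mod :: "nat \<Rightarrow> 'k::field mpoly set \<Rightarrow> 'k mpoly set set \<Rightarrow> nat" where
  "dim_mod n J V = ring.dim (mpoly_ring n Quot J) (scalars_mod n J) V"

definition quot_dim :: "nat \<Rightarrow> 'k::field mpoly set \<Rightarrow> nat" where
  "quot_dim n J = dim_mod n J (carrier (mpoly_ring n Quot J))"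

definition zero_dimensional :: "nat \<Rightarrow> 'k::field mpoly set \<Rightarrow> bool" where
  "zero_dimensional n I \<longleftrightarrow> ideal I (mpoly_ring n) \<and>
     carrier (mpoly_ring n Quot I) \<noteq> {\<zero>\<^bsub>mpoly_ring n Quot I\<^esub>} \<and>
     ring.finite_dimension (mpoly_ring n Quot I) (scalars_mod n I)
       (carrier (mpoly_ring n Quot I))"


section \<open>Minimal polynomials, squarefree parts, Frobenius spaces\<close>

text \<open>The monic generator of the kernel of \<open>K[z] \<rightarrow> P/J\<close>, \<open>z \<mapsto> f mod J\<close>.\<close>

definition min_poly :: "nat \<Rightarrow> 'k::field mpoly \<Rightarrow> 'k mpoly set \<Rightarrow> 'k poly" where
  "min_poly n f J = (THE \<mu>. lead_coeff \<mu> = 1 \<and>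
     {g. \<mu> dvd g} =
     {g. J +>\<^bsub>mpoly_ring n\<^esub> subst_poly g f = \<zero>\<^bsub>mpoly_ring n Quot J\<^esub>})"

text \<open>Monic representatives of the irreducible factors are used, which fixes the free constant.\<close>

definition sqfree :: "'k::field poly \<Rightarrow> 'k poly" where
  "sqfree g = \<Prod>{p. irreducible p \<and> lead_coeff p = 1 \<and> p dvd g}"

definition frobenius_space :: "nat \<Rightarrow> ('a, 'b) ring_scheme \<Rightarrow> 'a set" where
  "frobenius_space q R = {a \<in> carrier R. a [^]\<^bsub>R\<^esub> q \<ominus>\<^bsub>R\<^esub> a = \<zero>\<^bsub>R\<^esub>}"


section \<open>The procedure\<close>

text \<open>
  The first loop runs through the given list of indices in the state \<open>(J, d)\<close>. It either answers
  (\<^term>\<open>Inl b\<close>) or is left with a final state (\<^term>\<open>Inr (J, d)\<close>).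
\<close>

fun first_loop ::
  "nat \<Rightarrow> nat list \<Rightarrow> 'k::field mpoly set \<Rightarrow> nat \<Rightarrow> bool + ('k mpoly set \<times> nat)" where
  "first_loop n [] J d = Inr (J, d)"
| "first_loop n (i # is) J d =
     (let \<mu> = min_poly n (mvar i) J in
      if \<not> (\<exists>p k. irreducible p \<and> p dvd \<mu> \<and> \<mu> = p ^ k) then Inl False
      else if degree \<mu> = d then Inl True
      else if \<not> squarefree \<mu> then
        (let \<mu>' = sqfree \<mu>;
             J' = J <+>\<^bsub>mpoly_ring n\<^esub> Idl\<^bsub>mpoly_ring n\<^esub> {subst_poly \<mu>' (mvar i)};
             d' = quot_dim n J'
         in if degree \<mu>' = d' then Inl True else first_loop n is J' d')
      else first_loop n is J d)"

text \<open>
  The random picks are given by a stream, \<open>l 0\<close> being the next linear form. The value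
  \<^term>\<open>None\<close>, the least element of the option order, means that the loop does not terminate.
\<close>

partial_function (option) second_loop ::
  "nat \<Rightarrow> 'k::field mpoly set \<Rightarrow> nat \<Rightarrow> (nat \<Rightarrow> 'k mpoly) \<Rightarrow> bool option" where
  "second_loop n J d l =
     (let \<mu> = min_poly n (l 0) J in
      if \<not> irreducible \<mu> then Some False
      else if degree \<mu> = d then Some True
      else second_loop n J d (\<lambda>k. l (Suc k)))"

definition primary_test ::
  "nat \<Rightarrow> 'k::field mpoly set \<Rightarrow> (nat \<Rightarrow> 'k mpoly) \<Rightarrow> bool option" where
  "primary_test n I l =
     (case first_loop n [1..<Suc n] I (quot_dim n I) of
        Inl b \<Rightarrow> Some b
      | Inr (J, d) \<Rightarrow>
          if finite (UNIV :: 'k set) then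
            let s = dim_mod n I (frobenius_space (card (UNIV :: 'k set)) (mpoly_ring n Quot I))
            in Some (s = 1)
          else second_loop n J d l)"

end

theory Submission
  imports Defs "HOL-Computational_Algebra.Polynomial_Factorial"
begin

text \<open>
  For a zero-dimensional ideal \<open>J\<close> of \<open>P\<close>, being primary means that \<open>P/J\<close> is local: every element is a unit
  or nilpotent. This is the notion that the whole proof works with. The elements of \<open>P/J\<close> are handled by
  representatives, as congruences modulo \<open>J\<close> in the integral domain of all polynomials; this makes
  polynomials with coefficients in a subring of \<open>P/J\<close> available as elements of an ordinary polynomial type.

  Three observations make the answers of the loops correct. If \<open>P/J\<close> is local, then every minimal polynomial is a
  power of an irreducible polynomial (\<open>local_minpoly_prime_power\<close>). Conversely, if the degree of
  \<open>\<mu> = p\<^sup>k\<close> equals \<open>dim P/J\<close>, then \<open>P/J \<cong> K[z]/(p\<^sup>k)\<close>, which is local (\<open>local_if_generated\<close>,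
  \<open>generated_if_degree_minpoly\<close>). Finally, replacing \<open>J\<close> by \<open>J + \<langle>p(x\<^sub>i)\<rangle>\<close> with \<open>p(x\<^sub>i)\<close> nilpotent modulo \<open>J\<close> only divides
  out nilpotents, which does not affect locality (\<open>radical_extension\<close>, \<open>local_iff_radical\<close>).

  When the first loop ends without an answer, every \<open>x\<^sub>i\<close> satisfies modulo \<open>J\<close> an irreducible polynomial, which is
  separable because \<open>K\<close> is perfect. If \<open>P/J\<close> is local, it is then a field: adjoining
  a root of a separable polynomial to a subring without nilpotents creates no nilpotents
  (\<open>adjoin_separable_reduced\<close>, \<open>separable_variables_reduced\<close>). Hence all
  minimal polynomials are irreducible, and a reducible one in the second loop refutes locality.

  If \<open>K\<close> is finite with \<open>q\<close> elements, the Frobenius space always contains \<open>K\<close>. In a local algebra it is no larger: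
  \<open>a\<^sup>q - a\<close> is the product of all \<open>a - c\<close> with \<open>c \<in> K\<close>, so some \<open>a - c\<close> is nilpotent, and being itself fixed by the
  Frobenius map it vanishes (\<open>local_frobenius_fixed\<close>). An algebra that is not local has an
  idempotent other than \<open>0\<close> and \<open>1\<close> (\<open>not_local_idempotent\<close>), which is fixed and not in \<open>K\<close>.
\<close>

section \<open>Univariate polynomials over a field\<close>

lemma poly_ideal_principal:
  fixes S :: "'k::field poly set"
  assumes "p \<in> S" "p \<noteq> 0"
    and add: "\<And>a b. a \<in> S \<Longrightarrow> b \<in> S \<Longrightarrow> a + b \<in> S"
    and mult: "\<And>a c. a \<in> S \<Longrightarrow> c * a \<in> S"
  shows "\<exists>\<mu>. lead_coeff \<mu> = 1 \<and> (\<forall>g. \<mu> dvd g \<longleftrightarrow> g \<in> S)"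
proof -
  obtain m where m: "m \<in> S" "m \<noteq> 0" and min: "\<And>g. g \<in> S \<Longrightarrow> g \<noteq> 0 \<Longrightarrow> degree m \<le> degree g"
    using ex_has_least_nat[of "\<lambda>g. g \<in> S \<and> g \<noteq> 0" p degree] assms(1,2) by blast
  define \<mu> where "\<mu> = [:inverse (lead_coeff m):] * m"
  have \<mu>: "\<mu> \<in> S" "\<mu> \<noteq> 0" "degree \<mu> = degree m" "lead_coeff \<mu> = 1"
    using m mult[OF m(1), of "[:inverse (lead_coeff m):]"] by (simp_all add: \<mu>_def)
  have "\<mu> dvd g" if "g \<in> S" for g
  proof (rule ccontr)
    assume "\<not> \<mu> dvd g"
    then have "g mod \<mu> \<noteq> 0" by (simp add: dvd_eq_mod_eq_0)
    moreover have "g mod \<mu> = g + (- (g div \<mu>)) * \<mu>"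
      by (simp add: minus_div_mult_eq_mod[symmetric])
    then have "g mod \<mu> \<in> S" using that \<mu>(1) add mult by metis
    moreover have "degree (g mod \<mu>) < degree \<mu>"
      using degree_mod_less[of \<mu> g] \<mu>(2) \<open>g mod \<mu> \<noteq> 0\<close> by auto
    ultimately show False using min \<mu>(3) by fastforce
  qed
  moreover have "g \<in> S" if "\<mu> dvd g" for g
    using that mult[OF \<mu>(1)] by (auto simp: dvd_def mult.commute)
  ultimately show ?thesis using \<mu>(4) by blast
qed

lemma poly_bezout:
  fixes p q :: "'k::field poly"
  assumes "p \<noteq> 0" and unit: "\<And>d. d dvd p \<Longrightarrow> d dvd q \<Longrightarrow> is_unit d"
  shows "\<exists>u v. u * p + v * q = 1"
proof -
  define S where "S = {g. \<exists>u v. g = u * p + v * q}"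
  have pq: "p \<in> S" "q \<in> S"
    unfolding S_def by (auto intro: exI[of _ 1] exI[of _ 0])
  have add: "a + b \<in> S" if ab: "a \<in> S" "b \<in> S" for a b
  proof -
    obtain u v u' v' where "a = u * p + v * q" "b = u' * p + v' * q"
      using ab unfolding S_def by blast
    then have "a + b = (u + u') * p + (v + v') * q" by (simp add: algebra_simps)
    then show ?thesis unfolding S_def by blast
  qed
  have mult: "c * a \<in> S" if a: "a \<in> S" for a c
  proof -
    obtain u v where "a = u * p + v * q" using a unfolding S_def by blast
    then have "c * a = (c * u) * p + (c * v) * q" by (simp add: algebra_simps)
    then show ?thesis unfolding S_def by blast
  qed
  obtain \<mu> where \<mu>: "\<And>g. \<mu> dvd g \<longleftrightarrow> g \<in> S"
    using poly_ideal_principal[OF pq(1) assms(1) add mult] by blast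
  then have "is_unit \<mu>" using pq unit by blast
  then have "\<mu> dvd 1" by simp
  then show ?thesis using \<mu>[of 1] unfolding S_def by (auto intro: sym)
qed

lemma irreducible_poly_bezout:
  fixes p q :: "'k::field poly"
  assumes "irreducible p" "\<not> p dvd q"
  shows "\<exists>u v. u * p + v * q = 1"
proof (rule poly_bezout)
  show "p \<noteq> 0" using assms by auto
  show "is_unit d" if "d dvd p" "d dvd q" for d
    using that assms irreducibleD' dvd_trans by blast
qed

lemma poly_irreducible_factor:
  fixes g :: "'k::field poly"
  assumes "degree g > 0"
  obtains p where "irreducible p" "lead_coeff p = 1" "p dvd g"
proof -
  obtain p0 where p0: "p0 dvd g" "degree p0 > 0"
    and min0: "\<And>q. q dvd g \<Longrightarrow> degree q > 0 \<Longrightarrow> degree p0 \<le> degree q"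
    using ex_has_least_nat[of "\<lambda>p. p dvd g \<and> degree p > 0" g degree] assms by auto
  define p where "p = smult (inverse (lead_coeff p0)) p0"
  have "p0 \<noteq> 0" using p0 by auto
  then have p: "p dvd g" "degree p > 0" "lead_coeff p = 1"
    and min: "\<And>q. q dvd g \<Longrightarrow> degree q > 0 \<Longrightarrow> degree p \<le> degree q"
    using p0 min0 by (auto simp: p_def intro: smult_dvd)
  have "p \<noteq> 0" using p by auto
  have "irreducible p"
  proof (rule irreducibleI)
    show "p \<noteq> 0" by fact
    show "\<not> p dvd 1" using p(2) by (auto simp: is_unit_iff_degree \<open>p \<noteq> 0\<close>)
    fix a b assume ab: "p = a * b"
    then have nz: "a \<noteq> 0" "b \<noteq> 0" and deg: "degree p = degree a + degree b"
      using \<open>p \<noteq> 0\<close> by (auto simp: degree_mult_eq)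
    show "a dvd 1 \<or> b dvd 1"
    proof (cases "degree a = 0")
      case True then show ?thesis using nz by (simp add: is_unit_iff_degree)
    next
      case False
      have "a dvd g" using p(1) unfolding ab by (rule dvd_mult_left)
      then have "degree p \<le> degree a" by (rule min) (use False in simp)
      then have "degree b = 0" using deg by simp
      then show ?thesis using nz by (simp add: is_unit_iff_degree)
    qed
  qed
  then show thesis by (rule that[OF _ p(3,1)])
qed

lemma irreducible_degree_pos:
  fixes p :: "'k::field poly"
  assumes "irreducible p"
  shows "degree p > 0"
proof (rule ccontr)
  assume "\<not> degree p > 0"
  moreover have "p \<noteq> 0" using assms by auto
  ultimately have "is_unit p" by (simp add: is_unit_iff_degree)
  then show False using assms irreducible_not_unit by blast
qed

lemma irreducible_degree_1:
  fixes p :: "'k::field poly"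
  assumes "degree p = 1"
  shows "irreducible p"
proof (rule irreducibleI)
  show "p \<noteq> 0" using assms by auto
  then show "\<not> p dvd 1" using assms by (simp add: is_unit_iff_degree)
  fix a b assume ab: "p = a * b"
  then have nz: "a \<noteq> 0" "b \<noteq> 0" using \<open>p \<noteq> 0\<close> by auto
  then have "degree a + degree b = 1" using assms ab by (simp add: degree_mult_eq)
  then have "degree a = 0 \<or> degree b = 0" by arith
  then show "a dvd 1 \<or> b dvd 1" using nz by (simp add: is_unit_iff_degree)
qed

lemma monic_dvd_antisym:
  fixes p q :: "'k::field poly"
  assumes "p dvd q" "q dvd p" "lead_coeff p = 1" "lead_coeff q = 1"
  shows "p = q"
proof -
  obtain d where d: "q = p * d" using assms(1) by blast
  have nz: "p \<noteq> 0" "d \<noteq> 0" using assms d by auto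
  have "degree q \<le> degree p" by (rule dvd_imp_degree_le[OF assms(2) nz(1)])
  then have "degree d = 0" using d nz by (simp add: degree_mult_eq)
  then obtain a where a: "d = [:a:]" by (rule degree_eq_zeroE)
  have "lead_coeff q = lead_coeff p * lead_coeff d" unfolding d by (rule lead_coeff_mult)
  then have "a = 1" using assms(3,4) a by simp
  then show ?thesis using d a by simp
qed

lemma irreducible_dvd_unique:
  fixes p q :: "'k::field poly"
  assumes "irreducible p" "irreducible q" "p dvd q" "lead_coeff p = 1" "lead_coeff q = 1"
  shows "p = q"
proof (rule monic_dvd_antisym[OF assms(3) _ assms(4,5)])
  show "q dvd p" using irreducibleD'[OF assms(2,3)] irreducible_not_unit[OF assms(1)] by simp
qed

lemma irreducible_dvd_power:
  fixes p g :: "'k::field poly"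
  assumes "irreducible p" "p dvd g ^ k"
  shows "p dvd g"
  using field_poly_irreducible_imp_prime[OF assms(1)] assms(2) by (rule prime_elem_dvd_power)

text \<open>
  Split off one monic irreducible factor after the other: each divides \<open>p\<close>, hence equals \<open>p\<close>.
\<close>
lemma prime_power_if_dvd_power:
  fixes p \<mu> :: "'k::field poly"
  assumes p: "irreducible p" "lead_coeff p = 1" and \<mu>: "lead_coeff \<mu> = 1" "\<mu> dvd p ^ N"
  shows "\<exists>k. \<mu> = p ^ k"
  using \<mu>
proof (induction "degree \<mu>" arbitrary: \<mu> rule: less_induct)
  case less
  show ?case
  proof (cases "degree \<mu> = 0")
    case True
    then obtain a where "\<mu> = [:a:]" by (auto elim: degree_eq_zeroE)
    then have "\<mu> = p ^ 0" using less.prems(1) by (simp add: one_pCons)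
    then show ?thesis by blast
  next
    case False
    obtain r where r: "irreducible r" "lead_coeff r = 1" "r dvd \<mu>"
      using poly_irreducible_factor[of \<mu>] False by auto
    have "r dvd p" by (rule irreducible_dvd_power[OF r(1) dvd_trans[OF r(3) less.prems(2)]])
    then have "r = p" by (rule irreducible_dvd_unique[OF r(1) p(1) _ r(2) p(2)])
    then obtain \<nu> where \<nu>: "\<mu> = p * \<nu>" using r(3) by blast
    then have "\<mu> \<noteq> 0" using False by auto
    have pd: "degree p > 0" using p(1) by (rule irreducible_degree_pos)
    have "degree \<nu> < degree \<mu>" using \<nu> \<open>\<mu> \<noteq> 0\<close> pd by (auto simp: degree_mult_eq)
    moreover have "lead_coeff \<nu> = 1" using \<nu> p(2) less.prems(1) by (simp add: lead_coeff_mult)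
    moreover have "\<nu> dvd p ^ N" using less.prems(2) unfolding \<nu> by (rule dvd_mult_right)
    ultimately obtain k where "\<nu> = p ^ k" using less.hyps by blast
    then have "\<mu> = p ^ Suc k" using \<nu> by simp
    then show ?thesis by blast
  qed
qed

text \<open>
  The procedure tests for a power of any irreducible polynomial, whereas its squarefree part is
  formed from monic ones; a monic \<open>p ^ k\<close> is also a power of the monic associate of \<open>p\<close>.
\<close>
lemma monic_prime_power:
  fixes \<mu> :: "'k::field poly"
  assumes "lead_coeff \<mu> = 1" "degree \<mu> > 0" "irreducible p" "\<mu> = p ^ k"
  obtains r j where "irreducible r" "lead_coeff r = 1" "j > 0" "\<mu> = r ^ j"
proof -
  obtain r where r: "irreducible r" "lead_coeff r = 1" "r dvd \<mu>"
    using poly_irreducible_factor[OF assms(2)] by blast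
  have "r dvd p" using irreducible_dvd_power[OF r(1)] r(3) assms(4) by blast
  then have "p dvd r" using irreducibleD'[OF assms(3)] irreducible_not_unit[OF r(1)] by blast
  then have "\<mu> dvd r ^ k" unfolding assms(4) by (rule dvd_power_same)
  then obtain j where j: "\<mu> = r ^ j" using prime_power_if_dvd_power[OF r(1,2) assms(1)] by blast
  have "j > 0" using assms(2) j by (cases j) auto
  then show thesis using that r j by blast
qed

lemma sqfree_prime_power:
  fixes p :: "'k::field poly"
  assumes "irreducible p" "lead_coeff p = 1" "k > 0"
  shows "sqfree (p ^ k) = p"
proof -
  have "{q. irreducible q \<and> lead_coeff q = 1 \<and> q dvd p ^ k} = {p}"
  proof (intro equalityI subsetI)
    fix q assume "q \<in> {q. irreducible q \<and> lead_coeff q = 1 \<and> q dvd p ^ k}"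
    then have q: "irreducible q" "lead_coeff q = 1" "q dvd p ^ k" by auto
    have "q dvd p" by (rule irreducible_dvd_power[OF q(1,3)])
    then show "q \<in> {p}" using irreducible_dvd_unique[OF q(1) assms(1) _ q(2) assms(2)] by simp
  next
    fix q assume "q \<in> {p}"
    then show "q \<in> {q. irreducible q \<and> lead_coeff q = 1 \<and> q dvd p ^ k}"
      using assms by simp
  qed
  then show ?thesis by (simp add: sqfree_def)
qed

text \<open>
  In characteristic \<open>c > 0\<close> a polynomial with zero derivative involves only exponents divisible by \<open>c\<close>. As
  all its coefficients are \<open>c\<close>-th powers, it is itself a \<open>c\<close>-th power, by the Freshman's Dream.
\<close>
lemma irreducible_pderiv_nonzero:
  fixes p :: "'k::field poly"
  assumes "perfect_field TYPE('k)" "irreducible p"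
  shows "pderiv p \<noteq> 0"
proof
  assume 0: "pderiv p = 0"
  have deg: "degree p > 0" using assms(2) by (rule irreducible_degree_pos)
  have supp: "CHAR('k) dvd i" if i: "coeff p i \<noteq> 0" "i > 0" for i
  proof -
    obtain j where "i = Suc j" using i(2) by (cases i) auto
    then have "of_nat i * coeff p i = 0" using arg_cong[OF 0, of "\<lambda>g. coeff g j"] by (simp add: coeff_pderiv)
    then have "of_nat i = (0 :: 'k)" using i(1) by simp
    then show ?thesis by (simp add: of_nat_eq_0_iff_char_dvd)
  qed
  show False
  proof (cases "CHAR('k) = 0")
    case True
    moreover have "p \<noteq> 0" using assms(2) by auto
    ultimately show False using supp[of "degree p"] deg by simp
  next
    case False
    define c where "c = CHAR('k)"
    have prime: "prime c" unfolding c_def using False prime_CHAR_semidom by blast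
    obtain r :: "'k \<Rightarrow> 'k" where r: "\<And>a. r a ^ c = a"
      using assms(1) False unfolding perfect_field_def c_def by metis
    define q where "q = (\<Sum>j\<le>degree p. monom (r (coeff p (c * j))) j)"
    have "q ^ c = (\<Sum>j\<le>degree p. monom (r (coeff p (c * j))) j ^ c)"
      unfolding q_def by (rule freshmans_dream_sum) (use prime in \<open>simp_all add: c_def\<close>)
    also have "\<dots> = (\<Sum>j\<le>degree p. monom (coeff p (c * j)) (c * j))"
      by (simp add: monom_power r mult.commute)
    also have "\<dots> = p"
    proof (rule poly_eqI)
      fix i
      have "coeff (\<Sum>j\<le>degree p. monom (coeff p (c * j)) (c * j)) i
          = (\<Sum>j\<le>degree p. if c * j = i then coeff p i else 0)"
        by (auto simp: coeff_sum intro!: sum.cong)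
      also have "\<dots> = coeff p i"
      proof (cases "coeff p i = 0")
        case False
        then have "i \<le> degree p" "c dvd i" using supp[of i] by (auto simp: c_def le_degree)
        then obtain k where k: "i = c * k" by blast
        have c0: "c > 0" using prime by (rule prime_gt_0_nat)
        have "k \<le> c * k" using c0 by (cases c) auto
        then have "k \<le> degree p" using \<open>i \<le> degree p\<close> unfolding k by (rule le_trans)
        then show ?thesis using k c0 by simp
      qed (simp add: sum.neutral)
      finally show "coeff (\<Sum>j\<le>degree p. monom (coeff p (c * j)) (c * j)) i = coeff p i" .
    qed
    finally have pq: "p = q ^ c" by simp
    obtain c' where c': "c = Suc (Suc c')"
      using prime_gt_1_nat[OF prime] by (auto simp: less_iff_Suc_add)
    have "p = q * q ^ Suc c'" unfolding pq c' by (rule power_Suc)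
    then have "is_unit q \<or> is_unit (q ^ Suc c')" by (rule irreducibleD[OF assms(2)])
    then have "is_unit q" by (auto simp: is_unit_power_iff simp del: power_Suc)
    then have "is_unit p" unfolding pq by (simp add: is_unit_power_iff)
    then show False using assms(2) irreducible_not_unit by blast
  qed
qed

lemma irreducible_separable:
  fixes p :: "'k::field poly"
  assumes "perfect_field TYPE('k)" "irreducible p"
  shows "\<exists>u v. u * p + v * pderiv p = 1"
proof (rule irreducible_poly_bezout[OF assms(2)])
  have nz: "pderiv p \<noteq> 0" by (rule irreducible_pderiv_nonzero[OF assms])
  show "\<not> p dvd pderiv p"
  proof
    assume "p dvd pderiv p"
    then have "degree p \<le> degree (pderiv p)" using nz dvd_imp_degree_le by blast
    moreover have "degree (pderiv p) < degree p"
    proof (cases "degree p = 0")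
      case True
      then show ?thesis using nz by (auto elim!: degree_eq_zeroE simp: pderiv_pCons)
    next
      case False
      have "degree (pderiv p) \<le> degree p - 1"
        by (rule degree_le) (simp add: coeff_pderiv coeff_eq_0)
      then show ?thesis using False by simp
    qed
    ultimately show False by simp
  qed
qed

text \<open>
  Multiplication by \<open>x \<noteq> 0\<close> permutes the non-zero elements; compare their products before and after.
\<close>
lemma power_card_field:
  assumes "finite (UNIV :: 'k::field set)"
  shows "(x::'k) ^ card (UNIV :: 'k set) = x"
proof (cases "x = 0")
  case True
  then show ?thesis using assms by (simp add: finite_UNIV_card_ge_0 power_0_left)
next
  case False
  let ?U = "UNIV - {0::'k}"
  have "bij_betw ((*) x) ?U ?U"
    by (rule bij_betw_byWitness[where f' = "\<lambda>y. y / x"]) (use False in auto)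
  then have "(\<Prod>y\<in>?U. x * y) = \<Prod>?U" by (rule prod.reindex_bij_betw)
  then have "x ^ card ?U * \<Prod>?U = \<Prod>?U" by (simp add: prod.distrib)
  moreover have "\<Prod>?U \<noteq> 0" using assms by simp
  ultimately have "x ^ card ?U = 1" by simp
  moreover have "card (UNIV :: 'k set) = Suc (card ?U)"
    by (rule card.remove) (use assms in auto)
  ultimately show ?thesis by (simp only: power_Suc mult_1_right)
qed

lemma prod_linear_finite_field:
  assumes "finite (UNIV :: 'k::field set)"
  shows "(\<Prod>c\<in>(UNIV::'k set). [:- c, 1:]) = monom 1 (card (UNIV :: 'k set)) - monom 1 1"
    (is "?l = ?r")
proof -
  let ?q = "card (UNIV :: 'k set)"
  have q: "?q > 1"
    using card_mono[OF assms, of "{0,1}"] by simp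
  have deg: "degree ?l = ?q"
    by (subst degree_prod_eq_sum_degree) auto
  show ?thesis
  proof (rule poly_eqI_degree_lead_coeff[where A = UNIV and n = ?q])
    have "lead_coeff ?l = 1" by (simp add: lead_coeff_prod)
    then have "coeff ?l ?q = 1" unfolding deg .
    then show "coeff ?l ?q = coeff ?r ?q" using q by simp
    show "degree ?l \<le> ?q" using deg by (rule eq_imp_le)
    show "degree ?r \<le> ?q" using q by (intro degree_le) auto
    show "poly ?l x = poly ?r x" for x
    proof -
      have "poly ?l x = 0" using assms by (simp add: poly_prod)
      then show ?thesis by (simp add: poly_monom power_card_field[OF assms])
    qed
  qed (rule le_refl)
qed

text \<open>
  The polynomials \<open>(z + 1)\<^sup>q\<close> and \<open>z\<^sup>q + 1\<close> are monic of degree \<open>q\<close> and agree at all \<open>q\<close> elements of the field,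
  so they are equal. This yields additivity of \<open>x \<mapsto> x\<^sup>q\<close> without writing \<open>q\<close> as a prime power.
\<close>
lemma card_field_choose:
  assumes "finite (UNIV :: 'k::field set)" "0 < i" "i < card (UNIV :: 'k set)"
  shows "of_nat (card (UNIV :: 'k set) choose i) = (0 :: 'k)"
proof -
  let ?q = "card (UNIV :: 'k set)"
  have "[:1, 1:] ^ ?q = (monom 1 ?q + 1 :: 'k poly)" (is "?l = ?r")
  proof (rule poly_eqI_degree_lead_coeff[where A = UNIV and n = ?q])
    show "coeff ?l ?q = coeff ?r ?q" using assms(2,3) by (simp add: coeff_linear_poly_power)
    show "degree ?l \<le> ?q" by (simp add: degree_linear_power degree_power_eq)
    show "degree ?r \<le> ?q" by (intro degree_le) auto
    show "poly ?l x = poly ?r x" for x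
      by (simp add: poly_monom power_card_field[OF assms(1)])
  qed simp
  then have "coeff ?l i = coeff ?r i" by simp
  then show ?thesis using assms(2,3) by (simp add: coeff_linear_poly_power)
qed

section \<open>Congruence modulo an ideal of a subring\<close>

text \<open>
  The algebra \<open>C/J\<close> over the field \<open>K\<close>, where \<open>emb\<close> embeds \<open>K\<close> into the subring \<open>C\<close> of an integral domain.
  The set \<open>J\<close> is an ideal of \<open>C\<close> only; in the application \<open>C\<close> consists of
  the polynomials in the first \<open>n\<close> of infinitely many indeterminates.
\<close>

locale alg_quot =
  fixes emb :: "'k::field \<Rightarrow> 'a::idom" and C J :: "'a set"
  assumes emb_0: "emb 0 = 0" and emb_1: "emb 1 = 1"
    and emb_add: "emb (a + b) = emb a + emb b"
    and emb_mult: "emb (a * b) = emb a * emb b"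
    and emb_C: "emb a \<in> C"
    and add_C: "x \<in> C \<Longrightarrow> y \<in> C \<Longrightarrow> x + y \<in> C"
    and mult_C: "x \<in> C \<Longrightarrow> y \<in> C \<Longrightarrow> x * y \<in> C"
    and J_C: "J \<subseteq> C"
    and zero_J: "0 \<in> J"
    and add_J: "x \<in> J \<Longrightarrow> y \<in> J \<Longrightarrow> x + y \<in> J"
    and mult_J: "x \<in> C \<Longrightarrow> y \<in> J \<Longrightarrow> x * y \<in> J"
    and one_J: "1 \<notin> J"
begin

lemma emb_minus: "emb (- a) = - emb a"
  using emb_add[of "- a" a] by (simp add: emb_0 eq_neg_iff_add_eq_0)

lemma emb_diff: "emb (a - b) = emb a - emb b"
  using emb_add[of a "- b"] by (simp add: emb_minus)

lemma emb_sum: "emb (sum h A) = (\<Sum>i\<in>A. emb (h i))"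
  by (induction A rule: infinite_finite_induct) (simp_all add: emb_0 emb_add)

lemma emb_of_nat: "emb (of_nat m) = of_nat m"
  by (induction m) (simp_all add: emb_0 emb_1 emb_add)

lemma zero_C: "0 \<in> C" and one_C: "1 \<in> C"
  using emb_C[of 0] emb_C[of 1] by (simp_all add: emb_0 emb_1)

lemma uminus_C: "x \<in> C \<Longrightarrow> - x \<in> C"
  using mult_C[OF emb_C[of "- 1"]] by (simp add: emb_minus emb_1)

lemma diff_C: "x \<in> C \<Longrightarrow> y \<in> C \<Longrightarrow> x - y \<in> C"
  using add_C[OF _ uminus_C] by fastforce

lemma power_C: "x \<in> C \<Longrightarrow> x ^ m \<in> C"
  by (induction m) (simp_all add: one_C mult_C)

lemma sum_C: "(\<And>i. i \<in> A \<Longrightarrow> h i \<in> C) \<Longrightarrow> sum h A \<in> C"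
  by (induction A rule: infinite_finite_induct) (simp_all add: zero_C add_C)

lemmas closed_C = emb_C add_C mult_C zero_C one_C uminus_C diff_C power_C

lemma J_imp_C: "x \<in> J \<Longrightarrow> x \<in> C"
  using J_C by blast

lemma mult_J': "y \<in> J \<Longrightarrow> x \<in> C \<Longrightarrow> y * x \<in> J"
  using mult_J by (simp add: mult.commute)

lemma uminus_J: "x \<in> J \<Longrightarrow> - x \<in> J"
  using mult_J[OF uminus_C[OF one_C]] by fastforce

lemma diff_J: "x \<in> J \<Longrightarrow> y \<in> J \<Longrightarrow> x - y \<in> J"
  using add_J[OF _ uminus_J] by fastforce

lemma J_cong: "x - y \<in> J \<Longrightarrow> x \<in> J \<longleftrightarrow> y \<in> J"
  using add_J[of "x - y" y] diff_J[of x "x - y"] by auto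

lemma mult_cong_J: "x - x' \<in> J \<Longrightarrow> y - y' \<in> J \<Longrightarrow> x' \<in> C \<Longrightarrow> y \<in> C \<Longrightarrow> x * y - x' * y' \<in> J"
proof -
  assume "x - x' \<in> J" "y - y' \<in> J" "x' \<in> C" "y \<in> C"
  then have "(x - x') * y + x' * (y - y') \<in> J" by (intro add_J mult_J mult_J')
  then show ?thesis by (simp add: algebra_simps)
qed

lemma power_cong_J: "x - y \<in> J \<Longrightarrow> x \<in> C \<Longrightarrow> y \<in> C \<Longrightarrow> x ^ m - y ^ m \<in> J"
  by (induction m) (auto simp: zero_J intro!: mult_cong_J power_C)

lemma emb_J_iff: "emb c \<in> J \<longleftrightarrow> c = 0"
proof
  assume "emb c \<in> J"
  then have "emb (inverse c) * emb c \<in> J" by (rule mult_J[OF emb_C])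
  then show "c = 0" using one_J by (cases "c = 0") (simp_all add: emb_mult[symmetric] emb_1)
qed (simp add: emb_0 zero_J)

subsection \<open>Evaluation of polynomials\<close>

definition ev :: "'k poly \<Rightarrow> 'a \<Rightarrow> 'a" where
  "ev g f = poly (map_poly emb g) f"

lemma coeff_map_emb: "coeff (map_poly emb g) i = emb (coeff g i)"
  by (simp add: coeff_map_poly emb_0)

lemma map_emb_mult: "map_poly emb (g * h) = map_poly emb g * map_poly emb h"
  by (rule poly_eqI) (simp add: coeff_map_emb coeff_mult emb_sum emb_mult)

lemma map_emb_add: "map_poly emb (g + h) = map_poly emb g + map_poly emb h"
  by (rule poly_eqI) (simp add: coeff_map_emb emb_add)

lemma map_emb_pderiv: "map_poly emb (pderiv g) = pderiv (map_poly emb g)"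
  by (rule poly_eqI) (simp add: coeff_map_emb coeff_pderiv emb_add emb_mult emb_of_nat emb_1)

lemma ev_0: "ev 0 f = 0" by (simp add: ev_def)
lemma ev_pCons: "ev (pCons c g) f = emb c + f * ev g f"
  by (simp add: ev_def map_poly_pCons emb_0)
lemma ev_1: "ev 1 f = 1" by (simp add: ev_def emb_1)
lemma ev_add: "ev (g + h) f = ev g f + ev h f"
  by (simp add: ev_def map_emb_add)
lemma ev_mult: "ev (g * h) f = ev g f * ev h f"
  by (simp add: ev_def map_emb_mult)
lemma ev_uminus: "ev (- g) f = - ev g f"
  using ev_add[of "- g" g f] by (simp add: ev_0 eq_neg_iff_add_eq_0)
lemma ev_diff: "ev (g - h) f = ev g f - ev h f"
  using ev_add[of g "- h" f] by (simp add: ev_uminus)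
lemma ev_monom: "ev (monom 1 m) f = f ^ m"
  by (simp add: ev_def map_poly_monom emb_0 emb_1 poly_monom)
lemma ev_power: "ev (g ^ m) f = ev g f ^ m"
  by (induction m) (simp_all add: ev_1 ev_mult)
lemma ev_prod: "ev (prod h A) f = (\<Prod>i\<in>A. ev (h i) f)"
  by (induction A rule: infinite_finite_induct) (simp_all add: ev_1 ev_mult)

lemma ev_C: "f \<in> C \<Longrightarrow> ev g f \<in> C"
  by (induction g) (auto simp: ev_0 ev_pCons intro: closed_C)

lemma ev_dvd_J: "g dvd h \<Longrightarrow> ev g f \<in> J \<Longrightarrow> f \<in> C \<Longrightarrow> ev h f \<in> J"
  by (elim dvdE, simp only: ev_mult) (rule mult_J'[OF _ ev_C])

subsection \<open>Units and nilpotents modulo the ideal\<close>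

text \<open>
  The exponent \<open>0\<close> may be allowed in \<open>nilp\<close> because \<open>J\<close> is proper.
\<close>
definition unit where "unit a \<longleftrightarrow> (\<exists>u\<in>C. u * a - 1 \<in> J)"
definition nilp where "nilp a \<longleftrightarrow> (\<exists>m::nat. a ^ m \<in> J)"
definition is_local where "is_local \<longleftrightarrow> (\<forall>a\<in>C. unit a \<or> nilp a)"

lemma nilp_J: "a \<in> J \<Longrightarrow> nilp a"
  unfolding nilp_def by (rule exI[of _ 1]) simp

lemma nilp_mult: "nilp a \<Longrightarrow> c \<in> C \<Longrightarrow> nilp (c * a)"
  unfolding nilp_def by (auto simp: power_mult_distrib intro: mult_J power_C)

lemma nilp_uminus: "nilp a \<Longrightarrow> nilp (- a)"
  using nilp_mult[OF _ uminus_C[OF one_C], of a] by simp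

lemma nilp_cong: "nilp a \<Longrightarrow> a - b \<in> J \<Longrightarrow> a \<in> C \<Longrightarrow> b \<in> C \<Longrightarrow> nilp b"
  unfolding nilp_def using power_cong_J J_cong by blast

lemma nilp_pos: "nilp a \<Longrightarrow> \<exists>m>0. a ^ m \<in> J"
  unfolding nilp_def using one_J by (metis gr0I power_0)

lemma unit_cancel: "unit a \<Longrightarrow> a * b \<in> J \<Longrightarrow> a \<in> C \<Longrightarrow> b \<in> C \<Longrightarrow> b \<in> J"
proof -
  assume "unit a" and ab: "a * b \<in> J" "b \<in> C"
  then obtain u where u: "u \<in> C" "u * a - 1 \<in> J" unfolding unit_def by blast
  have "u * (a * b) - (u * a - 1) * b \<in> J" by (intro diff_J mult_J mult_J' u ab)
  then show ?thesis by (simp add: algebra_simps)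
qed

lemma unit_mult: "unit a \<Longrightarrow> unit b \<Longrightarrow> a \<in> C \<Longrightarrow> b \<in> C \<Longrightarrow> unit (a * b)"
proof -
  assume "unit a" "unit b" and ab: "a \<in> C" "b \<in> C"
  then obtain u v where u: "u \<in> C" "u * a - 1 \<in> J" and v: "v \<in> C" "v * b - 1 \<in> J"
    unfolding unit_def by blast
  have "(u * a - 1) * (v * b) + (v * b - 1) \<in> J" by (intro add_J mult_J' u v closed_C ab)
  then have "(u * v) * (a * b) - 1 \<in> J" by (simp add: algebra_simps)
  then show ?thesis using u v mult_C unfolding unit_def by blast
qed

lemma unit_prod: "(\<And>i. i \<in> A \<Longrightarrow> unit (h i) \<and> h i \<in> C) \<Longrightarrow> unit (prod h A) \<and> prod h A \<in> C"
proof (induction A rule: infinite_finite_induct)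
  case (insert x F)
  then show ?case by (auto intro: unit_mult mult_C)
qed (auto simp: unit_def zero_J one_C intro: bexI[of _ 1])

lemma unit_of_mult: "unit (a * b) \<Longrightarrow> b \<in> C \<Longrightarrow> unit a"
  unfolding unit_def by (metis mult_C mult.assoc mult.commute)

lemma unit_cong: "unit a \<Longrightarrow> a - b \<in> J \<Longrightarrow> unit b"
proof -
  assume "unit a" and ab: "a - b \<in> J"
  then obtain u where u: "u \<in> C" "u * a - 1 \<in> J" unfolding unit_def by blast
  have "(u * a - 1) - u * (a - b) \<in> J" by (intro diff_J mult_J u ab)
  then have "u * b - 1 \<in> J" by (simp add: algebra_simps)
  then show ?thesis using u unfolding unit_def by blast
qed

text \<open>
  The inverse of \<open>1 - t\<close> is the geometric sum in \<open>t\<close>.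
\<close>
lemma unit_one_minus: "nilp t \<Longrightarrow> t \<in> C \<Longrightarrow> unit (1 - t)"
proof -
  assume "nilp t" "t \<in> C"
  then obtain m where m: "t ^ m \<in> J" unfolding nilp_def by blast
  have "(\<Sum>i<m. t ^ i) * (1 - t) - 1 = - (t ^ m)"
    using one_diff_power_eq[of t m, symmetric] by (simp add: mult.commute)
  then have "(\<Sum>i<m. t ^ i) * (1 - t) - 1 \<in> J" using uminus_J[OF m] by simp
  moreover have "(\<Sum>i<m. t ^ i) \<in> C" using \<open>t \<in> C\<close> by (intro sum_C power_C)
  ultimately show ?thesis unfolding unit_def by blast
qed

lemma unit_nilp: "unit a \<Longrightarrow> nilp a \<Longrightarrow> a \<in> C \<Longrightarrow> False"
proof -
  assume "unit a" "nilp a" "a \<in> C"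
  then obtain u where u: "u \<in> C" "u * a - 1 \<in> J" unfolding unit_def by blast
  have "unit (1 - u * a)" using u \<open>nilp a\<close> \<open>a \<in> C\<close> by (intro unit_one_minus nilp_mult mult_C)
  moreover have "(1 - u * a) * 1 \<in> J" using uminus_J[OF u(2)] by simp
  ultimately have "1 \<in> J" using u \<open>a \<in> C\<close> by (intro unit_cancel[of "1 - u * a" 1] closed_C)
  then show False using one_J by simp
qed

lemma unit_add_nilp: "unit a \<Longrightarrow> nilp t \<Longrightarrow> a \<in> C \<Longrightarrow> t \<in> C \<Longrightarrow> unit (a + t)"
proof -
  assume "unit a" and t: "nilp t" "t \<in> C" and a: "a \<in> C"
  then obtain u where u: "u \<in> C" "u * a - 1 \<in> J" unfolding unit_def by blast
  have "unit (1 - u * (- t))" by (intro unit_one_minus nilp_mult nilp_uminus u t mult_C uminus_C)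
  moreover have "(1 - u * (- t)) - (u * (a + t)) \<in> J"
    using uminus_J[OF u(2)] by (simp add: algebra_simps)
  ultimately have "unit ((a + t) * u)" by (metis unit_cong mult.commute)
  then show ?thesis using unit_of_mult u by blast
qed

lemma local_nilp_iff: "is_local \<Longrightarrow> a \<in> C \<Longrightarrow> nilp a \<longleftrightarrow> \<not> unit a"
  unfolding is_local_def using unit_nilp by blast

text \<open>
  If \<open>a + b\<close> were a unit, then so would be \<open>a = (a + b) - b\<close>.
\<close>
lemma local_nilp_add: "is_local \<Longrightarrow> nilp a \<Longrightarrow> nilp b \<Longrightarrow> a \<in> C \<Longrightarrow> b \<in> C \<Longrightarrow> nilp (a + b)"
  using unit_add_nilp[of "a + b" "- b"] nilp_uminus local_nilp_iff add_C uminus_C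
  by (metis add_diff_cancel_right' diff_conv_add_uminus)

section \<open>Local algebras and minimal polynomials\<close>

definition primary where
  "primary \<longleftrightarrow> (\<forall>a\<in>C. \<forall>b\<in>C. a * b \<in> J \<longrightarrow> a \<in> J \<or> (\<exists>m>0. b ^ m \<in> J))"

lemma local_imp_primary: "is_local \<Longrightarrow> primary"
  unfolding primary_def
proof (intro ballI impI)
  fix a b assume "is_local" and ab: "a \<in> C" "b \<in> C" "a * b \<in> J"
  then consider "unit b" | "nilp b" unfolding is_local_def by blast
  then show "a \<in> J \<or> (\<exists>m>0. b ^ m \<in> J)"
  proof cases
    case 1
    then have "a \<in> J" using unit_cancel[of b a] ab by (simp add: mult.commute)
    then show ?thesis ..
  next
    case 2
    then show ?thesis using nilp_pos by blast
  qed
qed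

definition algebraic where
  "algebraic \<longleftrightarrow> (\<forall>f\<in>C. \<exists>g. g \<noteq> 0 \<and> ev g f \<in> J)"

text \<open>
  Writing an annihilating polynomial of least degree as \<open>c + z h(z)\<close>, minimality gives \<open>h(a) \<noteq> 0\<close> in the quotient.
  Then \<open>a\<close> has an inverse that is a polynomial in \<open>a\<close> if \<open>c \<noteq> 0\<close>, and is a zero divisor if \<open>c = 0\<close>.
\<close>
lemma least_annihilator:
  assumes algebraic "a \<in> C"
  obtains c h where "ev (pCons c h) a \<in> J" "ev h a \<notin> J"
proof -
  obtain g0 where "g0 \<noteq> 0" "ev g0 a \<in> J" using assms unfolding algebraic_def by blast
  then obtain g where g: "g \<noteq> 0" "ev g a \<in> J"
    and min: "\<And>h. h \<noteq> 0 \<Longrightarrow> ev h a \<in> J \<Longrightarrow> degree g \<le> degree h"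
    using ex_has_least_nat[of "\<lambda>g. g \<noteq> 0 \<and> ev g a \<in> J" g0 degree] by blast
  obtain c h where ch: "g = pCons c h" by (rule pCons_cases)
  have "h \<noteq> 0"
  proof
    assume "h = 0"
    then have "emb c \<in> J" using g(2) by (simp add: ch ev_pCons ev_0)
    then show False using g(1) ch \<open>h = 0\<close> by (simp add: emb_J_iff)
  qed
  then have "ev h a \<notin> J" using min[of h] ch by auto
  then show thesis using that g(2) ch by blast
qed

lemma annihilator_inverse:
  assumes "ev (pCons c h) a \<in> J" "c \<noteq> 0"
  shows "emb (- inverse c) * ev h a * a - 1 \<in> J"
proof -
  have "- (emb (inverse c) * ev (pCons c h) a) \<in> J" by (intro uminus_J mult_J emb_C assms(1))
  also have "- (emb (inverse c) * ev (pCons c h) a) = emb (- inverse c) * ev h a * a - emb (inverse c * c)"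
    by (simp add: ev_pCons emb_mult emb_minus algebra_simps)
  also have "emb (inverse c * c) = 1" using assms(2) by (simp add: emb_1)
  finally show ?thesis .
qed

lemma primary_imp_local:
  assumes algebraic primary
  shows is_local
  unfolding is_local_def
proof
  fix a assume a: "a \<in> C"
  obtain c h where ch: "ev (pCons c h) a \<in> J" "ev h a \<notin> J"
    using least_annihilator[OF assms(1) a] by blast
  show "unit a \<or> nilp a"
  proof (cases "c = 0")
    case True
    then have "ev h a * a \<in> J" using ch(1) by (simp add: ev_pCons emb_0 mult.commute)
    then have "\<exists>m>0. a ^ m \<in> J" using assms(2) a ch(2) ev_C unfolding primary_def by blast
    then show ?thesis unfolding nilp_def by blast
  next
    case False
    then show ?thesis unfolding unit_def using annihilator_inverse[OF ch(1)] a
      by (blast intro: mult_C emb_C ev_C)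
  qed
qed

text \<open>
  The inverse of \<open>a\<close> is a polynomial in \<open>a\<close> over \<open>K\<close>. So a subalgebra of a local algebra
  that has no nilpotents is a field.
\<close>
lemma inverse_in_subring:
  assumes algebraic is_local "B \<subseteq> C"
    and B: "\<And>c. emb c \<in> B" "\<And>x y. x \<in> B \<Longrightarrow> y \<in> B \<Longrightarrow> x + y \<in> B"
      "\<And>x y. x \<in> B \<Longrightarrow> y \<in> B \<Longrightarrow> x * y \<in> B"
    and a: "a \<in> B" "\<not> nilp a"
  shows "\<exists>u\<in>B. u * a - 1 \<in> J"
proof -
  have aC: "a \<in> C" using a assms(3) by blast
  have evB: "ev g a \<in> B" for g
    by (induction g) (use B(1)[of 0] B a in \<open>auto simp: ev_0 emb_0 ev_pCons\<close>)
  obtain c h where ch: "ev (pCons c h) a \<in> J" "ev h a \<notin> J"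
    using least_annihilator[OF assms(1) aC] by blast
  have "unit a" using local_nilp_iff[OF assms(2) aC] a(2) by blast
  have "c \<noteq> 0"
  proof
    assume "c = 0"
    then have "a * ev h a \<in> J" using ch(1) by (simp add: ev_pCons emb_0)
    then show False using unit_cancel[OF \<open>unit a\<close>] aC ev_C ch(2) by blast
  qed
  then show ?thesis using annihilator_inverse[OF ch(1)] B evB by blast
qed

definition minpoly where
  "minpoly \<mu> f \<longleftrightarrow> lead_coeff \<mu> = 1 \<and> (\<forall>g. \<mu> dvd g \<longleftrightarrow> ev g f \<in> J)"

lemma minpoly_dvd_iff: "minpoly \<mu> f \<Longrightarrow> \<mu> dvd g \<longleftrightarrow> ev g f \<in> J"
  and minpoly_monic: "minpoly \<mu> f \<Longrightarrow> lead_coeff \<mu> = 1"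
  by (simp_all add: minpoly_def)

lemma minpoly_root: "minpoly \<mu> f \<Longrightarrow> ev \<mu> f \<in> J"
  by (simp add: minpoly_dvd_iff[symmetric])

lemma ex_minpoly:
  assumes algebraic "f \<in> C"
  shows "\<exists>\<mu>. minpoly \<mu> f"
proof -
  obtain g where g: "g \<in> {g. ev g f \<in> J}" "g \<noteq> 0" using assms unfolding algebraic_def by blast
  show ?thesis unfolding minpoly_def
    using poly_ideal_principal[OF g] assms(2)
    by (auto simp: ev_add ev_mult intro: add_J mult_J ev_C)
qed

lemma minpoly_unique:
  assumes "minpoly \<mu> f" "minpoly \<nu> f"
  shows "\<mu> = \<nu>"
  using assms unfolding minpoly_def by (intro monic_dvd_antisym) auto

lemma minpoly_degree_pos:
  assumes "minpoly \<mu> f"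
  shows "degree \<mu> > 0"
proof (rule ccontr)
  assume "\<not> degree \<mu> > 0"
  then have "degree \<mu> = 0" by simp
  then obtain a where "\<mu> = [:a:]" by (rule degree_eq_zeroE)
  then have "\<mu> dvd 1" using assms unfolding minpoly_def by (simp add: one_pCons)
  then have "ev 1 f \<in> J" using assms unfolding minpoly_def by blast
  then show False using one_J by (simp add: ev_1)
qed

text \<open>
  For an irreducible factor \<open>p\<close> of \<open>\<mu>\<close>, the element \<open>p(f)\<close> is no unit: cancelling it would leave the
  proper divisor \<open>\<mu>/p\<close> as an annihilating polynomial. So \<open>p(f)\<close> is nilpotent, and \<open>\<mu>\<close> divides a power of \<open>p\<close>.
\<close>
lemma local_minpoly_prime_power:
  assumes is_local "minpoly \<mu> f" "f \<in> C"
  shows "\<exists>p k. irreducible p \<and> lead_coeff p = 1 \<and> k > 0 \<and> \<mu> = p ^ k"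
proof -
  have min: "\<And>g. \<mu> dvd g \<longleftrightarrow> ev g f \<in> J" and lc: "lead_coeff \<mu> = 1"
    using assms(2) unfolding minpoly_def by auto
  obtain p where p: "irreducible p" "lead_coeff p = 1" "p dvd \<mu>"
    using poly_irreducible_factor[OF minpoly_degree_pos[OF assms(2)]] by blast
  obtain h where h: "\<mu> = p * h" using p(3) by blast
  have "\<mu> \<noteq> 0" using lc by auto
  have "nilp (ev p f)"
  proof (rule ccontr)
    assume "\<not> nilp (ev p f)"
    then have "unit (ev p f)" using assms(1,3) ev_C local_nilp_iff by blast
    moreover have "ev p f * ev h f \<in> J" using min[of \<mu>] h by (simp add: ev_mult)
    ultimately have "ev h f \<in> J" using unit_cancel ev_C assms(3) by blast
    then have "p * h dvd h" using min[of h] h by simp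
    then have "degree (p * h) \<le> degree h" using \<open>\<mu> \<noteq> 0\<close> h by (intro dvd_imp_degree_le) auto
    then show False using irreducible_degree_pos[OF p(1)] \<open>\<mu> \<noteq> 0\<close> h by (auto simp: degree_mult_eq)
  qed
  then obtain m where "ev p f ^ m \<in> J" unfolding nilp_def by blast
  then have "\<mu> dvd p ^ m" using min by (simp add: ev_power)
  then obtain k where k: "\<mu> = p ^ k" using prime_power_if_dvd_power[OF p(1,2) lc] by blast
  have "k > 0" using minpoly_degree_pos[OF assms(2)] k by (cases k) auto
  then show ?thesis using p k by blast
qed

text \<open>
  Every element has the form \<open>g(f)\<close>. It is nilpotent if \<open>p\<close> divides \<open>g\<close>; otherwise \<open>u p + v g = 1\<close> for some
  \<open>u\<close> and \<open>v\<close>, and \<open>v(f) g(f)\<close> differs from \<open>1\<close> by a nilpotent.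
\<close>
lemma local_if_generated:
  assumes p: "irreducible p" "ev p f ^ k \<in> J"
    and gen: "\<And>a. a \<in> C \<Longrightarrow> \<exists>g. a - ev g f \<in> J" and f: "f \<in> C"
  shows is_local
  unfolding is_local_def
proof
  fix a assume a: "a \<in> C"
  obtain g where g: "a - ev g f \<in> J" using gen[OF a] by blast
  then have g': "ev g f - a \<in> J" using uminus_J by fastforce
  have np: "nilp (ev p f)" using p(2) unfolding nilp_def by blast
  show "unit a \<or> nilp a"
  proof (cases "p dvd g")
    case True
    then obtain h where "g = h * p" by (auto simp: dvd_def mult.commute)
    then have "nilp (ev g f)" using np f by (simp add: ev_mult nilp_mult ev_C)
    then show ?thesis using nilp_cong[OF _ g'] a f ev_C by blast
  next
    case False
    then obtain u v where "u * p + v * g = 1" using irreducible_poly_bezout[OF p(1)] by blast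
    then have "ev v f * ev g f = 1 - ev u f * ev p f"
      using ev_1[of f] by (metis ev_add ev_mult add_diff_cancel_left')
    moreover have "unit (1 - ev u f * ev p f)"
      using np f by (intro unit_one_minus nilp_mult mult_C ev_C)
    ultimately have "unit (ev g f * ev v f)" by (simp add: mult.commute)
    then have "unit (ev g f)" using unit_of_mult ev_C f by blast
    then show ?thesis using unit_cong[OF _ g'] by blast
  qed
qed

text \<open>
  Let \<open>z\<^sup>k h\<close> with \<open>h(0) \<noteq> 0\<close> annihilate an element \<open>a\<close> that is neither a unit nor nilpotent. With
  \<open>u z\<^sup>k + v h = 1\<close>, the element \<open>e = (u z\<^sup>k)(a)\<close> is idempotent. It is not \<open>0\<close>, as otherwise \<open>a\<^sup>k = 0\<close>, and
  not \<open>1\<close>, as otherwise \<open>a\<close> is a unit.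
\<close>
lemma not_local_idempotent:
  assumes algebraic "\<not> is_local"
  obtains e where "e \<in> C" "e * e - e \<in> J" "e \<notin> J" "e - 1 \<notin> J"
proof -
  obtain a where a: "a \<in> C" "\<not> unit a" "\<not> nilp a"
    using assms(2) unfolding is_local_def by blast
  obtain g0 where g0: "g0 \<noteq> 0" "ev g0 a \<in> J" using assms(1) a(1) unfolding algebraic_def by blast
  \<comment> \<open>The extra factor \<open>z\<close> ensures \<open>k > 0\<close>, from which \<open>e = 1\<close> makes \<open>a\<close> a unit.\<close>
  define g where "g = [:0, 1:] * g0"
  have g: "g \<noteq> 0" "ev g a \<in> J"
    using g0 a(1) by (auto simp: g_def ev_mult ev_pCons emb_0 emb_1 ev_0 intro: mult_J)
  obtain h where h: "g = [:- 0, 1:] ^ order 0 g * h" "\<not> [:- 0, 1:] dvd h"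
    using order_decomp[OF g(1)] by blast
  define k where "k = order 0 g"
  define z :: "'k poly" where "z = monom 1 1"
  have z: "z = [:- 0, 1:]" unfolding z_def by (simp add: monom_altdef)
  have "irreducible z" by (rule irreducible_degree_1) (simp add: z)
  have gh: "g = z ^ k * h" "\<not> z dvd h" using h unfolding z k_def by simp_all
  have "\<exists>u v. u * z ^ k + v * h = 1"
  proof (rule poly_bezout)
    show "z ^ k \<noteq> 0" using gh g(1) by auto
    fix d assume d: "d dvd z ^ k" "d dvd h"
    show "is_unit d"
    proof (rule ccontr)
      assume "\<not> is_unit d"
      moreover have "d \<noteq> 0" using d(1) \<open>z ^ k \<noteq> 0\<close> by auto
      ultimately have "degree d > 0" by (simp add: is_unit_iff_degree)
      then obtain r where r: "irreducible r" "lead_coeff r = 1" "r dvd d"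
        using poly_irreducible_factor by blast
      have "r dvd z" by (rule irreducible_dvd_power[OF r(1) dvd_trans[OF r(3) d(1)]])
      moreover have "lead_coeff z = 1" by (simp add: z)
      ultimately have "r = z" using irreducible_dvd_unique[OF r(1) \<open>irreducible z\<close>] r(2) by blast
      then show False using gh(2) dvd_trans[OF r(3) d(2)] by blast
    qed
  qed
  then obtain u v where uv: "u * z ^ k + v * h = 1" by blast
  define e where "e = ev (u * z ^ k) a"
  have zk: "ev (z ^ k) a = a ^ k" unfolding z_def by (simp add: ev_power ev_monom[of 1, simplified])
  have e1: "e = ev u a * a ^ k" by (simp add: e_def ev_mult zk)
  have e2: "1 - e = ev v a * ev h a"
    using arg_cong[OF uv, of "\<lambda>g. ev g a"] by (simp add: ev_add ev_1 e_def ev_mult algebra_simps)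
  have eC: "e \<in> C" unfolding e_def using a(1) by (rule ev_C)
  show thesis
  proof (rule that[OF eC])
    have "e * (1 - e) = (ev u a * ev v a) * ev g a"
      unfolding e2 by (simp add: e1 gh(1) ev_mult zk algebra_simps)
    also have "\<dots> \<in> J" by (intro mult_J mult_C ev_C a(1) g(2))
    finally have "- (e * (1 - e)) \<in> J" by (rule uminus_J)
    then show "e * e - e \<in> J" by (simp add: algebra_simps)
    show "e \<notin> J"
    proof
      assume "e \<in> J"
      have "ev v a * ev g a = a ^ k * (1 - e)" unfolding e2 by (simp add: gh(1) ev_mult zk)
      moreover have "ev v a * ev g a \<in> J" by (rule mult_J[OF ev_C[OF a(1)] g(2)])
      ultimately have "a ^ k * (1 - e) + a ^ k * e \<in> J"
        using mult_J[OF power_C[OF a(1)] \<open>e \<in> J\<close>] by (intro add_J) simp_all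
      then have "a ^ k \<in> J" by (simp add: algebra_simps)
      then show False using a(3) unfolding nilp_def by blast
    qed
    show "e - 1 \<notin> J"
    proof
      assume *: "e - 1 \<in> J"
      have "k \<noteq> 0"
      proof
        assume "k = 0"
        then have "h = z * g0" using gh(1) by (simp add: g_def z)
        then show False using gh(2) by simp
      qed
      then obtain k' where "k = Suc k'" by (cases k) auto
      then have "e = (ev u a * a ^ k') * a" using e1 by (simp add: algebra_simps)
      then have "unit a" unfolding unit_def using * a(1) by (metis mult_C ev_C power_C)
      then show False using a(2) by blast
    qed
  qed
qed

lemma power_card_add:
  assumes "finite (UNIV :: 'k set)"
  shows "((x :: 'a) + y) ^ card (UNIV :: 'k set) = x ^ card (UNIV :: 'k set) + y ^ card (UNIV :: 'k set)"
proof -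
  let ?q = "card (UNIV :: 'k set)"
  have "?q > 0" using assms by (simp add: finite_UNIV_card_ge_0)
  have "(x + y) ^ ?q = (\<Sum>i\<le>?q. of_nat (?q choose i) * x ^ i * y ^ (?q - i))"
    by (rule binomial_ring)
  also have "\<dots> = (\<Sum>i\<in>{0, ?q}. of_nat (?q choose i) * x ^ i * y ^ (?q - i))"
  proof (rule sum.mono_neutral_right)
    show "\<forall>i\<in>{..?q} - {0, ?q}. of_nat (?q choose i) * x ^ i * y ^ (?q - i) = 0"
    proof
      fix i assume "i \<in> {..?q} - {0, ?q}"
      then have "emb (of_nat (?q choose i)) = 0"
        using card_field_choose[OF assms, of i] by (simp add: emb_0)
      then have "of_nat (?q choose i) = (0 :: 'a)" by (simp only: emb_of_nat)
      then show "of_nat (?q choose i) * x ^ i * y ^ (?q - i) = 0" by simp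
    qed
  qed auto
  also have "\<dots> = x ^ ?q + y ^ ?q" using \<open>?q > 0\<close> by simp
  finally show ?thesis .
qed

lemma emb_power: "emb (c ^ m) = emb c ^ m"
  by (induction m) (simp_all add: emb_1 emb_mult)

text \<open>
  The product of all \<open>a - c\<close> vanishes, so some \<open>t = a - c\<close> is not a unit and hence nilpotent. Since also
  \<open>t\<^sup>q = t\<close>, the product of the unit \<open>1 - t\<^sup>q\<^sup>-\<^sup>1\<close> with \<open>t\<close> vanishes, and so does \<open>t\<close>.
\<close>
lemma local_frobenius_fixed:
  assumes is_local "finite (UNIV :: 'k set)" "a \<in> C" "a ^ card (UNIV :: 'k set) - a \<in> J"
  shows "\<exists>c. a - emb c \<in> J"
proof -
  let ?q = "card (UNIV :: 'k set)"
  have lin: "ev [:- c, 1:] a = a - emb c" for c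
    by (simp add: ev_pCons ev_0 emb_1 emb_minus emb_0)
  have "ev (\<Prod>c\<in>UNIV. [:- c, 1:]) a = a ^ ?q - a"
    unfolding prod_linear_finite_field[OF assms(2)] ev_diff ev_monom by simp
  then have "(\<Prod>c\<in>UNIV. a - emb c) \<in> J" using assms(4) by (simp add: ev_prod lin)
  then have "nilp (\<Prod>c\<in>UNIV. a - emb c)" by (rule nilp_J)
  then have "\<exists>c. \<not> unit (a - emb c)"
    using unit_prod[of UNIV "\<lambda>c. a - emb c"] unit_nilp diff_C[OF assms(3) emb_C] by blast
  then obtain c where "\<not> unit (a - emb c)" ..
  define t where "t = a - emb c"
  have t: "t \<in> C" "nilp t"
    using \<open>\<not> unit (a - emb c)\<close> assms(1,3) unfolding t_def is_local_def by (blast intro: diff_C emb_C)+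
  have q: "?q > 1" using card_mono[OF assms(2), of "{0,1}"] by simp
  have "t ^ ?q - t = (a ^ ?q - a) + ((emb (- c)) ^ ?q - emb (- c))"
    using power_card_add[OF assms(2), of a "emb (- c)"] by (simp add: t_def emb_minus)
  also have "emb (- c) ^ ?q = emb (- c)"
    unfolding emb_power[symmetric] power_card_field[OF assms(2)] ..
  finally have "- (t ^ ?q - t) \<in> J" using uminus_J[OF assms(4)] by simp
  also have "- (t ^ ?q - t) = (1 - t ^ (?q - 2) * t) * t"
  proof -
    obtain m where "?q = Suc (Suc m)" using q by (auto simp: less_iff_Suc_add)
    then show ?thesis by (simp add: algebra_simps)
  qed
  finally have "(1 - t ^ (?q - 2) * t) * t \<in> J" .
  moreover have "unit (1 - t ^ (?q - 2) * t)"
    by (intro unit_one_minus nilp_mult mult_C power_C t)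
  moreover have "1 - t ^ (?q - 2) * t \<in> C" by (intro diff_C one_C mult_C power_C t)
  ultimately have "t \<in> J" using unit_cancel t(1) by blast
  then show ?thesis unfolding t_def by blast
qed

section \<open>Adjoining a separable element\<close>

lemma sum_in_J: "(\<And>i. i \<in> A \<Longrightarrow> h i \<in> J) \<Longrightarrow> sum h A \<in> J"
  by (induction A rule: infinite_finite_induct) (simp_all add: zero_J add_J)

definition polys_over :: "'a set \<Rightarrow> 'a poly set" where
  "polys_over B = {g. \<forall>i. coeff g i \<in> B}"

definition subalg :: "'a set \<Rightarrow> bool" where
  "subalg B \<longleftrightarrow> B \<subseteq> C \<and> range emb \<subseteq> B \<and> (\<forall>x\<in>B. \<forall>y\<in>B. x + y \<in> B \<and> x * y \<in> B)"

context
  fixes B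
  assumes B: "subalg B"
begin

lemma subalg_facts:
  "x \<in> B \<Longrightarrow> x \<in> C" "emb c \<in> B" "x \<in> B \<Longrightarrow> y \<in> B \<Longrightarrow> x + y \<in> B" "x \<in> B \<Longrightarrow> y \<in> B \<Longrightarrow> x * y \<in> B"
  "0 \<in> B" "1 \<in> B"
proof -
  show emb: "emb c \<in> B" for c using B unfolding subalg_def by blast
  show "0 \<in> B" "1 \<in> B" using emb[of 0] emb[of 1] by (simp_all add: emb_0 emb_1)
qed (use B in \<open>auto simp: subalg_def\<close>)

lemma subalg_uminus: "x \<in> B \<Longrightarrow> - x \<in> B"
  using subalg_facts(4)[OF subalg_facts(2)[of "- 1"], of x] by (simp add: emb_minus emb_1)

lemma subalg_sum: "(\<And>i. i \<in> A \<Longrightarrow> h i \<in> B) \<Longrightarrow> sum h A \<in> B"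
  by (induction A rule: infinite_finite_induct) (simp_all add: subalg_facts)

lemma polys_over_add: "g \<in> polys_over B \<Longrightarrow> h \<in> polys_over B \<Longrightarrow> g + h \<in> polys_over B"
  unfolding polys_over_def by (simp add: subalg_facts)

lemma polys_over_mult: "g \<in> polys_over B \<Longrightarrow> h \<in> polys_over B \<Longrightarrow> g * h \<in> polys_over B"
  unfolding polys_over_def by (auto simp: coeff_mult intro!: subalg_sum subalg_facts(4))

lemma polys_over_uminus: "g \<in> polys_over B \<Longrightarrow> - g \<in> polys_over B"
  unfolding polys_over_def by (simp add: subalg_uminus)

lemma polys_over_diff: "g \<in> polys_over B \<Longrightarrow> h \<in> polys_over B \<Longrightarrow> g - h \<in> polys_over B"
  using polys_over_add[OF _ polys_over_uminus] by fastforce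

lemma polys_over_monom: "b \<in> B \<Longrightarrow> monom b k \<in> polys_over B"
  unfolding polys_over_def by (simp add: subalg_facts)

lemma polys_over_map_emb: "map_poly emb g \<in> polys_over B"
  unfolding polys_over_def by (simp add: coeff_map_emb subalg_facts)

lemma poly_C: "g \<in> polys_over B \<Longrightarrow> x \<in> C \<Longrightarrow> poly g x \<in> C"
  unfolding poly_altdef polys_over_def by (intro sum_C mult_C power_C) (auto intro: subalg_facts(1))

lemma polys_over_pderiv: "g \<in> polys_over B \<Longrightarrow> pderiv g \<in> polys_over B"
  unfolding polys_over_def
proof clarify
  fix i assume g: "\<forall>i. coeff g i \<in> B"
  have "emb (of_nat (Suc i)) * coeff g (Suc i) \<in> B" using g by (intro subalg_facts) auto
  then show "coeff (pderiv g) i \<in> B" unfolding emb_of_nat coeff_pderiv .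
qed

lemma poly_J: "\<forall>i. coeff g i \<in> J \<Longrightarrow> x \<in> C \<Longrightarrow> poly g x \<in> J"
  unfolding poly_altdef
  by (rule sum_in_J) (auto intro: mult_J' power_C)

lemma monic_division:
  assumes "m \<in> polys_over B" "lead_coeff m = 1" "g \<in> polys_over B"
  shows "\<exists>h\<in>polys_over B. \<exists>r\<in>polys_over B. g = m * h + r \<and> (\<forall>i\<ge>degree m. coeff r i = 0)"
proof -
  have "\<exists>h\<in>polys_over B. \<exists>r\<in>polys_over B. g = m * h + r \<and> (\<forall>i\<ge>degree m. coeff r i = 0)"
    if "g \<in> polys_over B" "\<forall>i\<ge>N. coeff g i = 0" for N g
    using that
  proof (induction N arbitrary: g)
    case 0
    then show ?case by (intro bexI[of _ 0] bexI[of _ g]) (auto simp: polys_over_def subalg_facts)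
  next
    case (Suc N)
    show ?case
    proof (cases "Suc N \<le> degree m")
      case True
      then show ?thesis using Suc.prems
        by (intro bexI[of _ 0] bexI[of _ g]) (auto simp: polys_over_def subalg_facts)
    next
      case False
      define k where "k = N - degree m"
      have N: "N = k + degree m" using False by (simp add: k_def)
      define b where "b = coeff g N"
      have b: "b \<in> B" using Suc.prems(1) by (simp add: b_def polys_over_def)
      define g' where "g' = g - monom b k * m"
      have "g' \<in> polys_over B" unfolding g'_def
        using Suc.prems(1) assms(1) b by (intro polys_over_diff polys_over_mult polys_over_monom)
      moreover have "coeff g' i = 0" if "i \<ge> N" for i
      proof (cases "i = N")
        case True
        then show ?thesis using N assms(2) by (simp add: g'_def b_def coeff_monom_mult)
      next
        case False
        then have "i \<ge> Suc N" "i - k > degree m" using that N by auto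
        then show ?thesis using Suc.prems(2) by (simp add: g'_def coeff_monom_mult coeff_eq_0)
      qed
      ultimately obtain h r where hr: "h \<in> polys_over B" "r \<in> polys_over B" "g' = m * h + r"
          "\<forall>i\<ge>degree m. coeff r i = 0"
        using Suc.IH by blast
      have "g = m * (h + monom b k) + r" using hr(3) by (simp add: g'_def algebra_simps)
      moreover have "h + monom b k \<in> polys_over B"
        using hr(1) b by (intro polys_over_add polys_over_monom)
      ultimately show ?thesis using hr(2,4) by blast
    qed
  qed
  from this[of g "Suc (degree g)"] show ?thesis using assms(3) by (simp add: coeff_eq_0)
qed

text \<open>
  Modulo \<open>J\<close> the subalgebra \<open>B\<close> is a field. Let \<open>m\<close> be a monic polynomial over \<open>B\<close> of least degree
  such that \<open>m(x)\<close> is nilpotent; it divides, modulo \<open>J\<close>, every polynomial \<open>f\<close> over \<open>B\<close> with \<open>f(x)\<close> nilpotent. In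
  particular \<open>p \<equiv> m h\<close>, and \<open>p'(x) \<equiv> m'(x) h(x) + m(x) h'(x)\<close> is a unit while \<open>m(x)\<close> is nilpotent, so
  \<open>h(x)\<close> is a unit. Now \<open>m(x) h(x) \<equiv> p(x) \<equiv> 0\<close> gives \<open>m(x) \<equiv> 0\<close>, which passes to all multiples of \<open>m\<close>.
\<close>
lemma adjoin_separable_reduced:
  assumes alg: algebraic and loc: is_local
    and red: "\<And>b. b \<in> B \<Longrightarrow> nilp b \<Longrightarrow> b \<in> J"
    and x: "x \<in> C" and p: "lead_coeff p = 1" "ev p x \<in> J" "unit (ev (pderiv p) x)"
    and g: "g \<in> polys_over B" "nilp (poly g x)"
  shows "poly g x \<in> J"
proof -
  let ?S = "\<lambda>m. m \<in> polys_over B \<and> lead_coeff m = 1 \<and> nilp (poly m x)"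
  have "?S (map_poly emb p)"
  proof (intro conjI)
    show "lead_coeff (map_poly emb p) = 1"
      using p(1) by (subst lead_coeff_map_poly_nz) (auto simp: emb_0 emb_1)
    show "nilp (poly (map_poly emb p) x)" using p(2) nilp_J unfolding ev_def by blast
  qed (rule polys_over_map_emb)
  then obtain m where m: "m \<in> polys_over B" "lead_coeff m = 1" "nilp (poly m x)"
    and min: "\<And>m'. ?S m' \<Longrightarrow> degree m \<le> degree m'"
    using ex_has_least_nat[of ?S "map_poly emb p" degree] by blast
  \<comment> \<open>Division by \<open>m\<close> leaves no remainder modulo \<open>J\<close>: a leading coefficient
    outside \<open>J\<close> could be normalised to \<open>1\<close>, contradicting the minimality of \<open>m\<close>.\<close>
  have small: "\<forall>i. coeff r i \<in> J"
    if "N \<le> degree m" "r \<in> polys_over B" "\<forall>i\<ge>N. coeff r i = 0" "nilp (poly r x)" for N r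
    using that
  proof (induction N arbitrary: r)
    case 0
    then show ?case by (simp add: zero_J)
  next
    case (Suc N)
    define b where "b = coeff r N"
    have b: "b \<in> B" using Suc.prems(2) by (simp add: b_def polys_over_def)
    define r' where "r' = r - monom b N"
    have r': "r' \<in> polys_over B" unfolding r'_def
      using Suc.prems(2) b by (intro polys_over_diff polys_over_monom)
    have r'0: "coeff r' i = 0" if "i \<ge> N" for i
      using that Suc.prems(3) by (cases "i = N") (auto simp: r'_def b_def)
    have rx: "poly r x = poly r' x + b * x ^ N" by (simp add: r'_def poly_monom)
    show ?case
    proof (cases "b \<in> J")
      case True
      have "poly r x - poly r' x \<in> J" using True x by (simp add: rx mult_J' power_C)
      then have "nilp (poly r' x)"
        using nilp_cong Suc.prems(2,4) r' poly_C x by blast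
      then have "\<forall>i. coeff r' i \<in> J" using Suc.IH[OF _ r'] Suc.prems(1) r'0 by simp
      moreover have "coeff r i = coeff r' i + (if i = N then b else 0)" for i
        by (simp add: r'_def)
      ultimately show ?thesis using True add_J zero_J by simp
    next
      case False
      then have "\<not> nilp b" using red b by blast
      then obtain u where u: "u \<in> B" "u * b - 1 \<in> J"
        using inverse_in_subring[OF alg loc _ subalg_facts(2-4) b] subalg_facts(1) by blast
      define s where "s = monom 1 N + monom u 0 * r'"
      have s: "s \<in> polys_over B" unfolding s_def
        using u r' by (intro polys_over_add polys_over_mult polys_over_monom subalg_facts)
      have c: "coeff s i = (if i = N then 1 else 0) + u * coeff r' i" for i
        by (auto simp: s_def coeff_monom_mult)
      have "degree s = N"
      proof (rule antisym)
        show "degree s \<le> N" by (rule degree_le) (simp add: c r'0)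
        show "N \<le> degree s" by (rule le_degree) (simp add: c r'0)
      qed
      have "lead_coeff s = 1" unfolding \<open>degree s = N\<close> by (simp add: c r'0)
      have "poly s x = u * poly r x - (u * b - 1) * x ^ N"
        by (simp add: s_def poly_monom rx algebra_simps)
      then have "u * poly r x - poly s x \<in> J" using u x by (simp add: mult_J' power_C)
      moreover have "nilp (u * poly r x)" using Suc.prems(4) u subalg_facts by (simp add: nilp_mult)
      ultimately have "nilp (poly s x)"
        using nilp_cong s Suc.prems(2) x u by (meson mult_C poly_C subalg_facts(1))
      then have "degree m \<le> degree s" using min s \<open>lead_coeff s = 1\<close> by blast
      then show ?thesis using Suc.prems(1) \<open>degree s = N\<close> by simp
    qed
  qed
  have div: "\<exists>h\<in>polys_over B. \<exists>r\<in>polys_over B. f = m * h + r \<and> (\<forall>i. coeff r i \<in> J)"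
    if f: "f \<in> polys_over B" "nilp (poly f x)" for f
  proof -
    obtain h r where hr: "h \<in> polys_over B" "r \<in> polys_over B" "f = m * h + r"
        "\<forall>i\<ge>degree m. coeff r i = 0"
      using monic_division[OF m(1,2) f(1)] by blast
    have "nilp (poly f x + - (poly h x * poly m x))"
      using f m(1,3) hr x by (intro local_nilp_add loc nilp_uminus nilp_mult poly_C uminus_C mult_C)
    moreover have "poly f x + - (poly h x * poly m x) = poly r x" by (simp add: hr(3) algebra_simps)
    ultimately have "\<forall>i. coeff r i \<in> J" using small[OF _ hr(2,4)] by simp
    then show ?thesis using hr by blast
  qed
  obtain h r where hr: "h \<in> polys_over B" "r \<in> polys_over B" "map_poly emb p = m * h + r"
      "\<forall>i. coeff r i \<in> J"
    using div \<open>?S (map_poly emb p)\<close> by blast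
  have hC: "poly h x \<in> C" "poly m x \<in> C" using poly_C hr(1) m(1) x by blast+
  have mh: "poly h x * poly m x \<in> J"
  proof -
    have "ev p x - poly r x \<in> J" by (intro diff_J p(2) poly_J hr(4) x)
    then show ?thesis by (simp add: ev_def hr(3) mult.commute)
  qed
  have "unit (poly h x)"
  proof (rule ccontr)
    assume "\<not> unit (poly h x)"
    then have nh: "nilp (poly h x)" using local_nilp_iff[OF loc] hC by blast
    have dC: "poly (pderiv h) x \<in> C" "poly (pderiv m) x \<in> C"
      using poly_C polys_over_pderiv hr(1) m(1) x by blast+
    have "\<forall>i. coeff (pderiv r) i \<in> J"
    proof
      fix i
      have "emb (of_nat (Suc i)) * coeff r (Suc i) \<in> J" using hr(4) by (intro mult_J emb_C) auto
      then show "coeff (pderiv r) i \<in> J" unfolding emb_of_nat coeff_pderiv .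
    qed
    then have rJ: "poly (pderiv r) x \<in> J" using poly_J x by blast
    have "ev (pderiv p) x = poly (pderiv h) x * poly m x + poly (pderiv m) x * poly h x + poly (pderiv r) x"
      by (simp add: ev_def map_emb_pderiv hr(3) pderiv_add pderiv_mult algebra_simps)
    moreover have "nilp (poly (pderiv h) x * poly m x + poly (pderiv m) x * poly h x + poly (pderiv r) x)"
      by (intro local_nilp_add loc nilp_mult m(3) nh nilp_J rJ J_imp_C dC hC add_C mult_C)
    ultimately show False using p(3) unit_nilp ev_C x by metis
  qed
  then have mJ: "poly m x \<in> J" using unit_cancel mh hC by blast
  obtain h' r' where hr': "h' \<in> polys_over B" "g = m * h' + r'" "\<forall>i. coeff r' i \<in> J"
    using div[OF g] by blast
  have "poly m x * poly h' x + poly r' x \<in> J"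
    using hr' x by (intro add_J mult_J' mJ poly_J poly_C)
  then show ?thesis by (simp add: hr'(2))
qed

end

end

section \<open>Quotients of polynomial rings\<close>

lemma mconst_hom:
  "mconst 0 = 0" "mconst 1 = 1" "mconst (a + b) = mconst a + mconst b"
  "mconst (a * b) = mconst a * mconst b"
  by (simp_all add: mconst_def single_add mult_single)

lemma carrier_mpoly_ring:
  "p \<in> carrier (mpoly_ring n) \<longleftrightarrow> (\<forall>m\<in>Poly_Mapping.keys p. Poly_Mapping.keys m \<subseteq> {1..n})"
  by (simp add: mpoly_ring_def)

lemma mpoly_ring_simps [simp]:
  "monoid.mult (mpoly_ring n) = (*)" "monoid.one (mpoly_ring n) = 1"
  "ring.zero (mpoly_ring n) = 0" "ring.add (mpoly_ring n) = (+)"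
  by (simp_all add: mpoly_ring_def)

lemma mconst_in_mpoly_ring: "mconst c \<in> carrier (mpoly_ring n)"
  by (auto simp: carrier_mpoly_ring mconst_def)

lemma mvar_in_mpoly_ring: "i \<in> {1..n} \<Longrightarrow> mvar i \<in> carrier (mpoly_ring n)"
  by (auto simp: carrier_mpoly_ring mvar_def)

lemma mpoly_ring_mono: "m \<le> n \<Longrightarrow> carrier (mpoly_ring m) \<subseteq> carrier (mpoly_ring n)"
  by (fastforce simp: carrier_mpoly_ring)

lemma mpoly_ring_0: "carrier (mpoly_ring 0) = range mconst"
proof
  show "carrier (mpoly_ring 0) \<subseteq> range (mconst :: 'k \<Rightarrow> 'k::field mpoly)"
  proof
    fix p :: "'k mpoly" assume "p \<in> carrier (mpoly_ring 0)"
    then have "Poly_Mapping.keys p \<subseteq> {0}" by (auto simp: carrier_mpoly_ring)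
    then have "p = mconst (Poly_Mapping.lookup p 0)"
      unfolding mconst_def
      by (intro poly_mapping_eqI) (auto simp: lookup_single when_def in_keys_iff)
    then show "p \<in> range mconst" by blast
  qed
qed (auto intro: mconst_in_mpoly_ring)

interpretation mpoly: cring "mpoly_ring n"
  by (rule cring_mpoly_ring)

lemma mpoly_ring_add:
  "x \<in> carrier (mpoly_ring n) \<Longrightarrow> y \<in> carrier (mpoly_ring n) \<Longrightarrow> x + y \<in> carrier (mpoly_ring n)"
  using mpoly.a_closed[of x n y] by simp

lemma mpoly_ring_mult:
  "x \<in> carrier (mpoly_ring n) \<Longrightarrow> y \<in> carrier (mpoly_ring n) \<Longrightarrow> x * y \<in> carrier (mpoly_ring n)"
  using mpoly.m_closed[of x n y] by simp

lemma mpoly_ring_uminus: "x \<in> carrier (mpoly_ring n) \<Longrightarrow> - x \<in> carrier (mpoly_ring n)"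
  by (simp add: carrier_mpoly_ring)

lemma mpoly_ring_a_inv: "x \<in> carrier (mpoly_ring n) \<Longrightarrow> \<ominus>\<^bsub>mpoly_ring n\<^esub> x = - x"
  by (rule mpoly.minus_equality) (simp_all add: mpoly_ring_uminus)

lemma mpoly_ring_nat_pow: "x [^]\<^bsub>mpoly_ring n\<^esub> (m::nat) = x ^ m"
  by (induction m) (simp_all add: mult.commute)

lemma list_in_image: "set ys \<subseteq> h ` A \<Longrightarrow> \<exists>xs. set xs \<subseteq> A \<and> ys = map h xs"
proof (induction ys)
  case (Cons y ys)
  then obtain x xs where "x \<in> A" "y = h x" "set xs \<subseteq> A" "ys = map h xs" by auto
  then show ?case by (intro exI[of _ "x # xs"]) simp
qed simp

locale mpoly_quot =
  fixes n :: nat and J :: "'k::field mpoly set"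
  assumes ideal_J: "ideal J (mpoly_ring n)" and proper_J: "1 \<notin> J"
begin

abbreviation "P \<equiv> mpoly_ring n :: 'k mpoly ring"
abbreviation "Q \<equiv> mpoly_ring n Quot J"
abbreviation "cls \<equiv> a_r_coset (mpoly_ring n) J"
abbreviation "S \<equiv> scalars_mod n J"

sublocale ideal J P by (rule ideal_J)

sublocale alg_quot mconst "carrier P" J
proof
  show "J \<subseteq> carrier P" by (rule a_subset)
  show "0 \<in> J" using additive_subgroup.zero_closed[OF additive_subgroup_axioms] by simp
  show "x + y \<in> J" if "x \<in> J" "y \<in> J" for x y
    using that a_closed by simp
  show "x * y \<in> J" if "x \<in> carrier P" "y \<in> J" for x y
    using that I_l_closed by simp
qed (use mpoly.a_closed mpoly.m_closed proper_J in
    \<open>simp_all add: mconst_hom mconst_in_mpoly_ring\<close>)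

lemma ev_eq: "ev g f = subst_poly g f"
  by (simp add: ev_def subst_poly_def)

sublocale h: ring_hom_ring P Q cls by (rule rcos_ring_hom_ring)

lemma cls_eq_iff: "x \<in> carrier P \<Longrightarrow> y \<in> carrier P \<Longrightarrow> cls x = cls y \<longleftrightarrow> x - y \<in> J"
proof -
  assume xy: "x \<in> carrier P" "y \<in> carrier P"
  have "cls x = cls y \<longleftrightarrow> x \<ominus>\<^bsub>P\<^esub> y \<in> J"
    using xy mpoly.quotient_eq_iff_same_a_r_cos[OF ideal_J] by simp
  then show ?thesis using xy by (simp add: a_minus_def mpoly_ring_a_inv)
qed

lemma cls_zero_iff: "x \<in> carrier P \<Longrightarrow> cls x = \<zero>\<^bsub>Q\<^esub> \<longleftrightarrow> x \<in> J"
  using cls_eq_iff[of x 0] zero_C h.hom_zero by simp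

lemma carrier_Q: "carrier Q = cls ` carrier P"
  by (auto simp: FactRing_def A_RCOSETS_def')

lemma subfield_mconst: "subfield (range mconst) P"
proof (rule mpoly.subfieldI)
  have "subring (range mconst) P"
  proof (rule mpoly.subringI)
    show "\<ominus>\<^bsub>P\<^esub> x \<in> range mconst" if "x \<in> range mconst" for x
      using that by (auto simp: mpoly_ring_a_inv emb_C emb_minus[symmetric])
    show "\<one>\<^bsub>P\<^esub> \<in> range mconst" using mconst_hom(2) by (metis mpoly_ring_simps(2) rangeI)
  qed (auto simp: emb_C mconst_hom(3,4)[symmetric])
  then show "subcring (range mconst) P"
    by (rule mpoly.subcringI) (auto simp: mult.commute)
  show "Units (P\<lparr>carrier := range mconst\<rparr>) = range mconst - {\<zero>\<^bsub>P\<^esub>}"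
  proof (intro equalityI subsetI)
    fix x assume "x \<in> Units (P\<lparr>carrier := range mconst\<rparr>)"
    then show "x \<in> range mconst - {\<zero>\<^bsub>P\<^esub>}" by (auto simp: Units_def)
  next
    fix x assume "x \<in> range mconst - {\<zero>\<^bsub>P\<^esub>}"
    then obtain c :: 'k where c: "x = mconst c" "c \<noteq> 0" using mconst_hom(1) by fastforce
    have "mconst (inverse c) * mconst c = (1 :: 'k mpoly)" "mconst c * mconst (inverse c) = (1 :: 'k mpoly)"
      using c by (simp_all add: mconst_hom(2,4)[symmetric])
    then show "x \<in> Units (P\<lparr>carrier := range mconst\<rparr>)" using c by (auto simp: Units_def)
  qed
qed

lemma scalars_eq: "S = cls ` range mconst"
  by (auto simp: scalars_mod_def)

lemma subfield_S: "subfield S Q"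
proof -
  have "\<one>\<^bsub>Q\<^esub> \<noteq> \<zero>\<^bsub>Q\<^esub>"
    using cls_zero_iff[OF one_C] h.hom_one one_J by simp
  then show ?thesis unfolding scalars_eq by (rule h.img_is_subfield(2)[OF subfield_mconst])
qed

section \<open>Dimension\<close>

lemma combine_powers:
  assumes f: "f \<in> carrier P" and "length cs \<le> m"
  shows "mpoly.combine n (map mconst cs) (map (\<lambda>i. f ^ i) [k..<k + m]) = f ^ k * ev (Poly cs) f"
  using assms(2)
proof (induction cs arbitrary: k m)
  case Nil
  then show ?case by (simp add: ev_0)
next
  case (Cons c cs)
  then obtain m' where m: "m = Suc m'" by (cases m) auto
  have "[k..<k + m] = k # [Suc k..<Suc k + m']" unfolding m by (simp add: upt_conv_Cons)
  then show ?case using Cons.IH[of m' "Suc k"] Cons.prems m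
    by (simp add: ev_pCons algebra_simps)
qed

lemma combine_cls_powers:
  assumes f: "f \<in> carrier P" and "length cs \<le> m"
  shows "h.S.combine (map (\<lambda>c. cls (mconst c)) cs) (map (\<lambda>i. cls (f ^ i)) [0..<m]) = cls (ev (Poly cs) f)"
proof -
  have "h.S.combine (map cls (map mconst cs)) (map cls (map (\<lambda>i. f ^ i) [0..<m]))
      = cls (mpoly.combine n (map mconst cs) (map (\<lambda>i. f ^ i) [0..<m]))"
    by (rule h.combine_hom) (auto intro: emb_C power_C f)
  then show ?thesis using combine_powers[OF assms, of 0] by (simp add: comp_def)
qed

lemma scalar_lists: "set Ks \<subseteq> S \<Longrightarrow> \<exists>cs. Ks = map (\<lambda>c. cls (mconst c)) cs"
  using list_in_image[of Ks "\<lambda>c. cls (mconst c)" UNIV] unfolding scalars_eq image_image by blast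

lemma Poly_eq_0_iff: "Poly cs = 0 \<longleftrightarrow> set cs \<subseteq> {0}"
  by (induction cs) auto

lemma degree_Poly_less: "Poly cs \<noteq> 0 \<Longrightarrow> degree (Poly cs) < length cs"
proof (rule ccontr)
  assume "Poly cs \<noteq> 0" "\<not> degree (Poly cs) < length cs"
  then have "coeff (Poly cs) (degree (Poly cs)) = 0"
    by (simp add: coeff_Poly_eq nth_default_def)
  then show False using \<open>Poly cs \<noteq> 0\<close> leading_coeff_0_iff by blast
qed

lemma cls_in_Q: "x \<in> carrier P \<Longrightarrow> cls x \<in> carrier Q"
  using carrier_Q by blast

lemma minpoly_min_poly:
  assumes "minpoly \<mu> f" "f \<in> carrier P"
  shows "min_poly n f J = \<mu>"
proof -
  have eq: "{g. cls (subst_poly g f) = \<zero>\<^bsub>Q\<^esub>} = {g. ev g f \<in> J}"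
    using cls_zero_iff ev_C[OF assms(2)] by (auto simp: ev_eq)
  show ?thesis unfolding min_poly_def
  proof (rule the_equality)
    show "lead_coeff \<mu> = 1 \<and> {g. \<mu> dvd g} = {g. cls (subst_poly g f) = \<zero>\<^bsub>Q\<^esub>}"
      using assms(1) unfolding eq minpoly_def by auto
    show "\<nu> = \<mu>" if "lead_coeff \<nu> = 1 \<and> {g. \<nu> dvd g} = {g. cls (subst_poly g f) = \<zero>\<^bsub>Q\<^esub>}" for \<nu>
      using that minpoly_unique[OF _ assms(1)] unfolding eq minpoly_def by auto
  qed
qed

definition finite_dim where
  "finite_dim \<longleftrightarrow> h.S.finite_dimension S (carrier Q)"

text \<open>
  Representatives of a spanning list modulo \<open>J\<close> also span modulo the larger ideal.
\<close>
lemma finite_dim_mono: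
  assumes "mpoly_quot n J'" "J \<subseteq> J'" finite_dim
  shows "mpoly_quot.finite_dim n J'"
proof -
  interpret J': mpoly_quot n J' by fact
  let ?K = "range (mconst :: 'k \<Rightarrow> 'k mpoly)"
  obtain d where "h.S.dimension d S (carrier Q)"
    using assms(3) unfolding finite_dim_def by blast
  then obtain Vs where Vs: "set Vs \<subseteq> carrier Q" "h.S.Span S Vs = carrier Q"
    using h.S.exists_base[OF subfield_S] by blast
  obtain fs where fs: "Vs = map cls fs" "set fs \<subseteq> carrier P"
    using list_in_image[of Vs cls] Vs(1) unfolding carrier_Q by blast
  have K: "?K \<subseteq> carrier P" using emb_C by blast
  have span: "cls ` mpoly.Span n ?K fs = carrier Q"
    using h.Span_hom[OF K fs(2)] Vs(2) fs(1) by (simp add: scalars_eq)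
  have spanC: "mpoly.Span n ?K fs \<subseteq> carrier P"
    by (rule mpoly.Span_in_carrier[OF K fs(2)])
  have "carrier J'.Q \<subseteq> J'.h.S.Span J'.S (map J'.cls fs)"
  proof
    fix y assume "y \<in> carrier J'.Q"
    then obtain a where a: "a \<in> carrier P" "y = J'.cls a" unfolding J'.carrier_Q by blast
    have "cls a \<in> cls ` mpoly.Span n ?K fs" unfolding span using a(1) by (rule cls_in_Q)
    then obtain b where b: "b \<in> mpoly.Span n ?K fs" "cls a = cls b" by blast
    have "a - b \<in> J'" using cls_eq_iff[of a b] a(1) b spanC assms(2) by blast
    then have "y = J'.cls b" using J'.cls_eq_iff[of a b] a b(1) spanC by blast
    then have "y \<in> J'.cls ` mpoly.Span n ?K fs" using b(1) by blast
    then show "y \<in> J'.h.S.Span J'.S (map J'.cls fs)"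
      using J'.h.Span_hom[OF K fs(2)] by (simp add: J'.scalars_eq)
  qed
  moreover have fsQ: "set (map J'.cls fs) \<subseteq> carrier J'.Q" using fs(2) J'.carrier_Q by auto
  then have "J'.h.S.Span J'.S (map J'.cls fs) \<subseteq> carrier J'.Q"
    using J'.h.S.Span_subgroup_props(1)[OF J'.subfield_S] by blast
  ultimately have "carrier J'.Q = J'.h.S.Span J'.S (map J'.cls fs)" by blast
  then show ?thesis unfolding J'.finite_dim_def
    using J'.h.S.Span_finite_dimension[OF J'.subfield_S fsQ] by simp
qed

context
  assumes fin: finite_dim
begin

lemma dimension_Q: "h.S.dimension (quot_dim n J) S (carrier Q)"
  using h.S.finite_dimensionE[OF subfield_S] fin
  by (simp add: finite_dim_def quot_dim_def dim_mod_def over_def)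

text \<open>
  The \<open>d + 1\<close> powers \<open>1, f, \<dots>, f\<^sup>d\<close> are linearly dependent in dimension \<open>d\<close>.
\<close>
lemma finite_dim_algebraic: algebraic
  unfolding algebraic_def
proof
  fix f assume f: "f \<in> carrier P"
  let ?d = "quot_dim n J"
  define Us where "Us = map (\<lambda>i. cls (f ^ i)) [0..<Suc ?d]"
  have UsQ: "set Us \<subseteq> carrier Q"
    using f by (auto simp: Us_def intro!: cls_in_Q power_C)
  have len: "length Us = Suc ?d" by (simp add: Us_def)
  have "\<not> h.S.independent S Us"
    using h.S.independent_length_le_dimension[OF subfield_S dimension_Q _ UsQ] len by auto
  then obtain Ks where Ks: "length Ks = length Us" "h.S.combine Ks Us = \<zero>\<^bsub>Q\<^esub>" "set Ks \<subseteq> S"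
      "set Ks \<noteq> {\<zero>\<^bsub>Q\<^esub>}"
    using h.S.dependent_imp_non_trivial_combine[OF subfield_S UsQ] by blast
  obtain cs where cs: "Ks = map (\<lambda>c. cls (mconst c)) cs" using scalar_lists[OF Ks(3)] by blast
  have "length cs \<le> Suc ?d" using Ks(1) len cs by simp
  then have "cls (ev (Poly cs) f) = \<zero>\<^bsub>Q\<^esub>"
    using combine_cls_powers[OF f] Ks(2) unfolding cs Us_def by metis
  then have "ev (Poly cs) f \<in> J" using cls_zero_iff ev_C f by blast
  moreover have "Poly cs \<noteq> 0"
  proof
    assume "Poly cs = 0"
    then have "set cs \<subseteq> {0}" by (simp add: Poly_eq_0_iff)
    moreover have "cs \<noteq> []" using Ks(1) len cs by auto
    ultimately have "set cs = {0}" by (metis set_empty subset_singletonD)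
    then have "set Ks = {\<zero>\<^bsub>Q\<^esub>}"
      unfolding cs using h.hom_zero by (simp add: mconst_hom)
    then show False using Ks(4) by blast
  qed
  ultimately show "\<exists>g. g \<noteq> 0 \<and> ev g f \<in> J" by blast
qed

text \<open>
  The powers of \<open>f\<close> below the degree of \<open>\<mu>\<close> are independent; if there are as many of them as the dimension, they form a basis.
\<close>
lemma generated_if_degree_minpoly:
  assumes f: "f \<in> carrier P" and \<mu>: "minpoly \<mu> f" "degree \<mu> = quot_dim n J" and a: "a \<in> carrier P"
  shows "\<exists>g. a - ev g f \<in> J"
proof -
  let ?d = "quot_dim n J"
  define Us where "Us = map (\<lambda>i. cls (f ^ i)) [0..<?d]"
  have UsQ: "set Us \<subseteq> carrier Q"
    using f by (auto simp: Us_def intro!: cls_in_Q power_C)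
  have len: "length Us = ?d" by (simp add: Us_def)
  have "h.S.independent S Us"
  proof (rule h.S.trivial_combine_imp_independent[OF subfield_S UsQ])
    fix Ks assume Ks: "set Ks \<subseteq> S" "h.S.combine Ks Us = \<zero>\<^bsub>Q\<^esub>"
    have "set (take ?d Ks) \<subseteq> S" using Ks(1) by (meson set_take_subset subset_trans)
    then obtain cs where cs: "take ?d Ks = map (\<lambda>c. cls (mconst c)) cs"
      using scalar_lists by blast
    have lcs: "length cs \<le> ?d" using arg_cong[OF cs, of length] by simp
    have "h.S.combine (take ?d Ks) Us = \<zero>\<^bsub>Q\<^esub>"
      using h.S.combine_take[of Us Ks] Ks(2) len by simp
    then have "cls (ev (Poly cs) f) = \<zero>\<^bsub>Q\<^esub>"
      using combine_cls_powers[OF f lcs] unfolding cs Us_def by simp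
    then have "\<mu> dvd Poly cs" using cls_zero_iff ev_C f \<mu>(1) unfolding minpoly_def by blast
    have "Poly cs = 0"
    proof (rule ccontr)
      assume nz: "Poly cs \<noteq> 0"
      then have "degree \<mu> \<le> degree (Poly cs)" using \<open>\<mu> dvd Poly cs\<close> dvd_imp_degree_le by blast
      then show False using degree_Poly_less[OF nz] lcs \<mu>(2) by simp
    qed
    then have "set cs \<subseteq> {0}" by (simp add: Poly_eq_0_iff)
    then show "set (take (length Us) Ks) \<subseteq> {\<zero>\<^bsub>Q\<^esub>}"
      unfolding len cs using h.hom_zero by (auto simp: mconst_hom)
  qed
  then have "h.S.Span S Us = carrier Q"
    using h.S.independent_length_eq_dimension[OF subfield_S dimension_Q _ UsQ] len by blast
  then have "cls a \<in> h.S.Span S Us" using cls_in_Q[OF a] by simp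
  then obtain Ks where Ks: "set Ks \<subseteq> S" "length Ks = length Us" "cls a = h.S.combine Ks Us"
    using h.S.Span_mem_iff_length_version[OF subfield_S UsQ] by blast
  obtain cs where cs: "Ks = map (\<lambda>c. cls (mconst c)) cs" using scalar_lists[OF Ks(1)] by blast
  have "length cs \<le> ?d" using Ks(2) len cs by simp
  then have "cls a = cls (ev (Poly cs) f)"
    using combine_cls_powers[OF f] Ks(3) unfolding cs Us_def by metis
  then show ?thesis using cls_eq_iff a ev_C[OF f] by blast
qed

text \<open>
  The Frobenius space is a subspace that contains the line \<open>K\<close>, so its dimension is \<open>1\<close> iff it equals \<open>K\<close>.
\<close>
lemma frobenius_dim_eq_1_iff:
  assumes finK: "finite (UNIV :: 'k set)"
  shows "dim_mod n J (frobenius_space (card (UNIV :: 'k set)) Q) = 1 \<longleftrightarrow> is_local"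
proof -
  let ?q = "card (UNIV :: 'k set)"
  define F where "F = frobenius_space ?q Q"
  have q: "?q > 0" using finK by (simp add: finite_UNIV_card_ge_0)
  have F: "F = cls ` {a \<in> carrier P. a ^ ?q - a \<in> J}"
  proof -
    have "cls a [^]\<^bsub>Q\<^esub> ?q \<ominus>\<^bsub>Q\<^esub> cls a = \<zero>\<^bsub>Q\<^esub> \<longleftrightarrow> a ^ ?q - a \<in> J" if a: "a \<in> carrier P" for a
    proof -
      have "cls a [^]\<^bsub>Q\<^esub> ?q = cls (a ^ ?q)"
        using h.hom_nat_pow[OF a, of ?q] by (simp add: mpoly_ring_nat_pow)
      then have "cls a [^]\<^bsub>Q\<^esub> ?q \<ominus>\<^bsub>Q\<^esub> cls a = \<zero>\<^bsub>Q\<^esub> \<longleftrightarrow> cls (a ^ ?q) = cls a"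
        using h.S.r_right_minus_eq[of "cls (a ^ ?q)" "cls a"] a cls_in_Q power_C by simp
      then show ?thesis using cls_eq_iff a power_C by blast
    qed
    then show ?thesis unfolding F_def frobenius_space_def carrier_Q by blast
  qed
  have constF: "S \<subseteq> F"
    unfolding scalars_eq F
    by (auto simp: emb_power[symmetric] power_card_field[OF finK] emb_C zero_J)
  have FQ: "F \<subseteq> carrier Q" unfolding F carrier_Q by blast
  have add: "x \<oplus>\<^bsub>Q\<^esub> y \<in> F" if xy: "x \<in> F" "y \<in> F" for x y
  proof -
    obtain a b where ab: "a \<in> carrier P" "b \<in> carrier P" "x = cls a" "y = cls b"
        "a ^ ?q - a \<in> J" "b ^ ?q - b \<in> J"
      using xy unfolding F by blast
    have "(a + b) ^ ?q - (a + b) = (a ^ ?q - a) + (b ^ ?q - b)"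
      unfolding power_card_add[OF finK] by simp
    then have "(a + b) ^ ?q - (a + b) \<in> J" using add_J[OF ab(5,6)] by (simp only:)
    moreover have "x \<oplus>\<^bsub>Q\<^esub> y = cls (a + b)" using h.hom_add[of a b] ab by simp
    ultimately show ?thesis using ab add_C unfolding F by blast
  qed
  have mult: "x \<otimes>\<^bsub>Q\<^esub> y \<in> F" if xy: "x \<in> F" "y \<in> F" for x y
  proof -
    obtain a b where ab: "a \<in> carrier P" "b \<in> carrier P" "x = cls a" "y = cls b"
        "a ^ ?q - a \<in> J" "b ^ ?q - b \<in> J"
      using xy unfolding F by blast
    have "(a * b) ^ ?q - (a * b) \<in> J"
      unfolding power_mult_distrib using ab by (intro mult_cong_J power_C)
    moreover have "x \<otimes>\<^bsub>Q\<^esub> y = cls (a * b)" using h.hom_mult[of a b] ab by simp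
    ultimately show ?thesis using ab mult_C unfolding F by blast
  qed
  have "subalgebra S F Q"
  proof (intro subalgebra.intro subalgebra_axioms.intro)
    show "subgroup F (add_monoid Q)"
    proof (rule h.S.add.subgroupI)
      show "F \<subseteq> carrier Q" by fact
      show "F \<noteq> {}" using constF subringE(2)[OF subfieldE(1)[OF subfield_S]] by blast
      show "\<ominus>\<^bsub>Q\<^esub> x \<in> F" if x: "x \<in> F" for x
      proof -
        have xQ: "x \<in> carrier Q" using x FQ by blast
        have "\<ominus>\<^bsub>Q\<^esub> \<one>\<^bsub>Q\<^esub> \<in> S" by (intro subringE(3,5)[OF subfieldE(1)[OF subfield_S]])
        then have "(\<ominus>\<^bsub>Q\<^esub> \<one>\<^bsub>Q\<^esub>) \<otimes>\<^bsub>Q\<^esub> x \<in> F" using mult x constF by blast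
        then show ?thesis using h.S.l_minus[OF h.S.one_closed xQ] xQ by simp
      qed
      show "x \<oplus>\<^bsub>Q\<^esub> y \<in> F" if "x \<in> F" "y \<in> F" for x y using that by (rule add)
    qed
    show "k \<otimes>\<^bsub>Q\<^esub> v \<in> F" if "k \<in> S" "v \<in> F" for k v using that mult constF by blast
  qed
  then have "h.S.finite_dimension S F"
    using h.S.subalbegra_incl_imp_finite_dimension[OF subfield_S _ _ FQ] fin
    unfolding finite_dim_def by blast
  then have dimF: "h.S.dimension (dim_mod n J F) S F"
    using h.S.finite_dimensionE[OF subfield_S] by (simp add: dim_mod_def over_def)
  have one_iff: "dim_mod n J F = 1 \<longleftrightarrow> F = S"
  proof
    assume 1: "dim_mod n J F = 1"
    obtain Us where Us: "h.S.independent S Us" "length Us = 1" "h.S.Span S Us = S"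
      using h.S.exists_base[OF subfield_S h.S.dimension_one[OF subfield_S]] by blast
    have "set Us \<subseteq> S"
      using h.S.Span_base_incl[OF subfield_S h.S.independent_in_carrier[OF Us(1)]] Us(3) by blast
    then have "set Us \<subseteq> F" using constF by blast
    then show "F = S"
      using h.S.independent_length_eq_dimension[OF subfield_S dimF Us(1)] Us(2,3) 1 by simp
  next
    assume "F = S"
    then show "dim_mod n J F = 1"
      using h.S.dimI[OF subfield_S h.S.dimension_one[OF subfield_S]]
      by (simp add: dim_mod_def over_def)
  qed
  have "F = S \<longleftrightarrow> is_local"
  proof
    assume FS: "F = S"
    show is_local
    proof (rule ccontr)
      assume "\<not> is_local"
      then obtain e where e: "e \<in> carrier P" "e * e - e \<in> J" "e \<notin> J" "e - 1 \<notin> J"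
        using not_local_idempotent[OF finite_dim_algebraic] by blast
      have "e ^ Suc m - e \<in> J" for m
      proof (induction m)
        case (Suc m)
        have "e * (e ^ Suc m - e) + (e * e - e) \<in> J" by (intro add_J mult_J e Suc)
        then show ?case by (simp add: algebra_simps)
      qed (simp add: zero_J)
      from this[of "?q - 1"] have "e ^ ?q - e \<in> J" using q by simp
      then have "cls e \<in> S" using e(1) FS unfolding F by blast
      then obtain c where "cls e = cls (mconst c)" unfolding scalars_eq by blast
      then have ec: "e - mconst c \<in> J" using cls_eq_iff e(1) emb_C by blast
      have "e * e - mconst c * mconst c \<in> J" using ec e(1) emb_C by (intro mult_cong_J)
      from diff_J[OF diff_J[OF this e(2)] ec] have "mconst (c - c * c) \<in> J"
        by (simp add: emb_diff emb_mult)
      then have "c - c * c = 0" by (simp only: emb_J_iff)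
      then have "c * (1 - c) = 0" by (simp add: algebra_simps)
      then have "c = 0 \<or> c = 1" by simp
      then show False using ec e(3,4) by (auto simp: mconst_hom)
    qed
  next
    assume loc: is_local
    have "F \<subseteq> S"
    proof
      fix x assume "x \<in> F"
      then obtain a where a: "a \<in> carrier P" "a ^ ?q - a \<in> J" "x = cls a" unfolding F by blast
      obtain c where "a - mconst c \<in> J" using local_frobenius_fixed[OF loc finK a(1,2)] by blast
      then have "x = cls (mconst c)" using cls_eq_iff a(1,3) emb_C by blast
      then show "x \<in> S" unfolding scalars_eq by blast
    qed
    then show "F = S" using constF by blast
  qed
  then show ?thesis using one_iff unfolding F_def by simp
qed

end

end

section \<open>Reducedness in several indeterminates\<close>

lemma poly_mapping_expand:
  "p = (\<Sum>m\<in>Poly_Mapping.keys p. Poly_Mapping.single m (Poly_Mapping.lookup p m))"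
proof (rule poly_mapping_eqI)
  fix k
  have "Poly_Mapping.lookup (\<Sum>m\<in>Poly_Mapping.keys p. Poly_Mapping.single m (Poly_Mapping.lookup p m)) k
      = (\<Sum>m\<in>Poly_Mapping.keys p. if m = k then Poly_Mapping.lookup p k else 0)"
    by (auto simp: lookup_sum lookup_single when_def intro!: sum.cong)
  also have "\<dots> = Poly_Mapping.lookup p k" by (auto simp: in_keys_iff)
  finally show "Poly_Mapping.lookup p k = Poly_Mapping.lookup
      (\<Sum>m\<in>Poly_Mapping.keys p. Poly_Mapping.single m (Poly_Mapping.lookup p m)) k" by simp
qed

lemma mvar_power: "mvar i ^ e = Poly_Mapping.single (Poly_Mapping.single i e) 1"
proof (induction e)
  case 0
  then show ?case by simp
next
  case (Suc e)
  have "Poly_Mapping.single i (1::nat) + Poly_Mapping.single i e = Poly_Mapping.single i (Suc e)"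
    by (simp add: single_add[symmetric])
  then show ?case using Suc by (simp add: mvar_def mult_single)
qed

lemma mpoly_ring_Suc_poly:
  assumes "f \<in> carrier (mpoly_ring (Suc i))"
  shows "\<exists>g. (\<forall>j. coeff g j \<in> carrier (mpoly_ring i)) \<and> f = poly g (mvar (Suc i))"
proof -
  let ?x = "mvar (Suc i) :: 'a mpoly"
  have "\<exists>g. (\<forall>j. coeff g j \<in> carrier (mpoly_ring i)) \<and> Poly_Mapping.single m c = poly g ?x"
    if m: "Poly_Mapping.keys m \<subseteq> {1..Suc i}" for m and c :: 'a
  proof -
    define e where "e = Poly_Mapping.lookup m (Suc i)"
    define m' where "m' = m - Poly_Mapping.single (Suc i) e"
    have lk: "Poly_Mapping.lookup m' j = (if j = Suc i then 0 else Poly_Mapping.lookup m j)" for j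
      by (simp add: m'_def lookup_minus lookup_single when_def e_def)
    have mm: "m = m' + Poly_Mapping.single (Suc i) e"
      by (rule poly_mapping_eqI) (simp add: lookup_add lk lookup_single when_def e_def)
    have "Poly_Mapping.keys m' \<subseteq> {1..i}"
    proof
      fix j assume "j \<in> Poly_Mapping.keys m'"
      then have "j \<noteq> Suc i" "j \<in> Poly_Mapping.keys m" by (auto simp: in_keys_iff lk split: if_splits)
      then show "j \<in> {1..i}" using m by fastforce
    qed
    then have "Poly_Mapping.single m' c \<in> carrier (mpoly_ring i)"
      by (auto simp: carrier_mpoly_ring)
    moreover have "(0 :: 'a mpoly) \<in> carrier (mpoly_ring i)" by (simp add: carrier_mpoly_ring)
    ultimately have "\<forall>j. coeff (monom (Poly_Mapping.single m' c) e) j \<in> carrier (mpoly_ring i)"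
      by simp
    moreover have "Poly_Mapping.single m c = poly (monom (Poly_Mapping.single m' c) e) ?x"
      by (simp add: poly_monom mvar_power mult_single mm[symmetric])
    ultimately show ?thesis by blast
  qed
  note mono = this
  have "\<exists>g. (\<forall>j. coeff g j \<in> carrier (mpoly_ring i)) \<and> (\<Sum>m\<in>A. Poly_Mapping.single m (c m)) = poly g ?x"
    if "finite A" "\<forall>m\<in>A. Poly_Mapping.keys m \<subseteq> {1..Suc i}" for A and c :: "_ \<Rightarrow> 'a"
    using that
  proof (induction A)
    case empty
    then show ?case by (intro exI[of _ 0]) (simp add: carrier_mpoly_ring)
  next
    case (insert m A)
    obtain g where g: "\<forall>j. coeff g j \<in> carrier (mpoly_ring i)"
        "(\<Sum>m\<in>A. Poly_Mapping.single m (c m)) = poly g ?x"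
      using insert by auto
    obtain h where h: "\<forall>j. coeff h j \<in> carrier (mpoly_ring i)" "Poly_Mapping.single m (c m) = poly h ?x"
      using mono insert.prems by blast
    have "\<forall>j. coeff (h + g) j \<in> carrier (mpoly_ring i)"
      using g(1) h(1) by (auto intro: mpoly_ring_add)
    then show ?case using g(2) h(2) insert.hyps by (intro exI[of _ "h + g"]) simp
  qed
  from this[of "Poly_Mapping.keys f" "Poly_Mapping.lookup f"] show ?thesis
    using assms poly_mapping_expand[of f] by (auto simp: carrier_mpoly_ring)
qed

lemma linear_form_in_mpoly_ring:
  assumes "linear_form n l"
  shows "l \<in> carrier (mpoly_ring n)"
proof -
  obtain c where l: "l = (\<Sum>i=1..n. mconst (c i) * mvar i)" using assms unfolding linear_form_def by blast
  have "(\<Sum>i\<in>A. mconst (c i) * mvar i) \<in> carrier (mpoly_ring n)" if "A \<subseteq> {1..n}" for A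
    using finite_subset[OF that finite_atLeastAtMost] that
  proof (induction A)
    case empty
    then show ?case by (simp add: carrier_mpoly_ring)
  next
    case (insert i A)
    have "mconst (c i) * mvar i \<in> carrier (mpoly_ring n)"
      by (intro mpoly_ring_mult mconst_in_mpoly_ring mvar_in_mpoly_ring) (use insert.prems in blast)
    then show ?case using insert by (simp add: mpoly_ring_add)
  qed
  then show ?thesis unfolding l by blast
qed

context mpoly_quot
begin

text \<open>
  Induction over the subalgebras generated by \<open>x\<^sub>1, \<dots>, x\<^sub>i\<close>: the field \<open>K\<close> has no nilpotents, and each step
  adjoins one element that satisfies a separable polynomial. This is the local case of Seidenberg's lemma.
\<close>
lemma separable_variables_reduced:
  assumes perf: "perfect_field TYPE('k)" and alg: algebraic and loc: is_local
    and vars: "\<And>i. i \<in> {1..n} \<Longrightarrow> \<exists>p. irreducible p \<and> ev p (mvar i) \<in> J"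
    and a: "a \<in> carrier P" "nilp a"
  shows "a \<in> J"
proof -
  have "\<forall>b\<in>carrier (mpoly_ring i). nilp b \<longrightarrow> b \<in> J" if "i \<le> n" for i
    using that
  proof (induction i)
    case 0
    show ?case
    proof (intro ballI impI)
      fix b assume "b \<in> carrier (mpoly_ring 0)" and b: "nilp b"
      then obtain c :: 'k where c: "b = mconst c" unfolding mpoly_ring_0 by blast
      then obtain m where "mconst (c ^ m) \<in> J" using b unfolding nilp_def by (auto simp: emb_power)
      then have "c = 0" by (simp add: emb_J_iff)
      then show "b \<in> J" using c zero_J by (simp add: mconst_hom)
    qed
  next
    case (Suc i)
    let ?B = "carrier (mpoly_ring i) :: 'k mpoly set" and ?x = "mvar (Suc i) :: 'k mpoly"
    have B: "subalg ?B"
      using subsetD[OF mpoly_ring_mono[of i n]] Suc.prems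
      unfolding subalg_def by (auto intro: mconst_in_mpoly_ring mpoly_ring_add mpoly_ring_mult)
    have x: "?x \<in> carrier P" by (rule mvar_in_mpoly_ring) (use Suc.prems in simp)
    obtain p0 where p0: "irreducible p0" "ev p0 ?x \<in> J" using vars[of "Suc i"] Suc.prems by auto
    obtain p where p: "irreducible p" "lead_coeff p = 1" "p dvd p0" "p0 dvd p"
    proof -
      obtain p where p: "irreducible p" "lead_coeff p = 1" "p dvd p0"
        using poly_irreducible_factor[OF irreducible_degree_pos[OF p0(1)]] by blast
      have "p0 dvd p" using p(3) irreducibleD'[OF p0(1)] irreducible_not_unit[OF p(1)] by blast
      then show thesis using that p by blast
    qed
    have px: "ev p ?x \<in> J" by (rule ev_dvd_J[OF p(4) p0(2) x])
    obtain u v where "u * p + v * pderiv p = 1" using irreducible_separable[OF perf p(1)] by blast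
    then have "ev u ?x * ev p ?x + ev v ?x * ev (pderiv p) ?x = 1"
      by (metis ev_1 ev_add ev_mult)
    then have "ev v ?x * ev (pderiv p) ?x - 1 = - (ev u ?x * ev p ?x)" by (simp add: algebra_simps)
    then have "ev v ?x * ev (pderiv p) ?x - 1 \<in> J" using x px by (simp add: uminus_J mult_J ev_C)
    then have un: "unit (ev (pderiv p) ?x)" using ev_C[OF x] unfolding unit_def by blast
    have red: "b \<in> J" if "b \<in> ?B" "nilp b" for b
      using Suc that by simp
    show ?case
    proof (intro ballI impI)
      fix f assume "f \<in> carrier (mpoly_ring (Suc i))" "nilp f"
      then obtain g where g: "g \<in> polys_over ?B" "f = poly g ?x"
        using mpoly_ring_Suc_poly[of f i] unfolding polys_over_def by auto
      then have "nilp (poly g ?x)" using \<open>nilp f\<close> by simp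
      then show "f \<in> J"
        using adjoin_separable_reduced[OF B alg loc red x p(2) px un g(1)] g(2) by simp
    qed
  qed
  then show ?thesis using a by blast
qed

lemma local_reduced_minpoly_irreducible:
  assumes loc: is_local and red: "\<And>a. a \<in> carrier P \<Longrightarrow> nilp a \<Longrightarrow> a \<in> J"
    and \<mu>: "minpoly \<mu> f" and f: "f \<in> carrier P"
  shows "irreducible \<mu>"
proof -
  obtain p k where p: "irreducible p" "lead_coeff p = 1" "k > 0" "\<mu> = p ^ k"
    using local_minpoly_prime_power[OF loc \<mu> f] by (elim exE conjE)
  have "ev p f ^ k \<in> J" using minpoly_root[OF \<mu>] unfolding p(4) ev_power .
  then have "nilp (ev p f)" unfolding nilp_def by (rule exI)
  then have "ev p f \<in> J" by (rule red[OF ev_C[OF f]])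
  then have "\<mu> dvd p" using minpoly_dvd_iff[OF \<mu>] by simp
  moreover have "p dvd \<mu>" unfolding p(4) using p(3) by simp
  ultimately have "\<mu> = p" using p(2) minpoly_monic[OF \<mu>] by (intro monic_dvd_antisym)
  then show ?thesis using p(1) by simp
qed

end

section \<open>The two loops\<close>

lemma local_iff_radical:
  assumes "alg_quot emb C J" "alg_quot emb C J'" "J \<subseteq> J'" "\<forall>a\<in>J'. \<exists>m::nat. a ^ m \<in> J"
  shows "alg_quot.is_local C J' \<longleftrightarrow> alg_quot.is_local C J"
proof -
  interpret A: alg_quot emb C J by fact
  interpret B: alg_quot emb C J' by fact
  have nilp: "A.nilp a \<longleftrightarrow> B.nilp a" for a
    using assms(3,4) unfolding A.nilp_def B.nilp_def by (metis power_mult subsetD)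
  have unit: "A.unit a \<longleftrightarrow> B.unit a" if a: "a \<in> C" for a
  proof
    assume "A.unit a" then show "B.unit a" using assms(3) unfolding A.unit_def B.unit_def by blast
  next
    assume "B.unit a"
    then obtain u where u: "u \<in> C" "u * a - 1 \<in> J'" unfolding B.unit_def by blast
    then have "A.nilp (u * a - 1)" using assms(4) unfolding A.nilp_def by blast
    then have "A.nilp (1 - u * a)" using A.nilp_uminus by fastforce
    then have "A.unit (1 - (1 - u * a))" using u a by (intro A.unit_one_minus A.diff_C A.mult_C A.one_C)
    then have "A.unit (a * u)" by (simp add: mult.commute)
    then show "A.unit a" using A.unit_of_mult u(1) by blast
  qed
  show ?thesis using nilp unit unfolding A.is_local_def B.is_local_def by blast
qed

locale zd_quot = mpoly_quot +
  assumes fin: finite_dim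
begin

lemma ex_min_poly:
  assumes "f \<in> carrier P"
  shows "minpoly (min_poly n f J) f"
  using ex_minpoly[OF finite_dim_algebraic[OF fin] assms] minpoly_min_poly[OF _ assms] by metis

lemma local_if_degree_min_poly:
  assumes f: "f \<in> carrier P" and p: "irreducible p" "ev p f ^ k \<in> J"
    and deg: "degree (min_poly n f J) = quot_dim n J"
  shows is_local
  using local_if_generated[OF p generated_if_degree_minpoly[OF fin f ex_min_poly[OF f] deg] f] .

lemma radical_extension:
  assumes g: "g \<in> carrier P" "g ^ k \<in> J"
  defines "J' \<equiv> J <+>\<^bsub>P\<^esub> Idl\<^bsub>P\<^esub> {g}"
  shows "zd_quot n J'" "J \<subseteq> J'" "g \<in> J'" "\<forall>a\<in>J'. \<exists>m::nat. a ^ m \<in> J"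
proof -
  have Idl: "Idl\<^bsub>P\<^esub> {g} = {x * g | x. x \<in> carrier P}"
    using mpoly.cgenideal_eq_genideal[OF g(1)] by (simp add: cgenideal_def)
  have J': "J' = {a + x * g | a x. a \<in> J \<and> x \<in> carrier P}"
    unfolding J'_def Idl set_add_def' by auto
  show sub: "J \<subseteq> J'"
  proof
    fix a assume "a \<in> J"
    moreover have "a = a + 0 * g" by simp
    ultimately show "a \<in> J'" unfolding J' using zero_C by blast
  qed
  have "g = 0 + 1 * g" by simp
  then show "g \<in> J'" unfolding J' using zero_J one_C by blast
  show rad: "\<forall>a\<in>J'. \<exists>m::nat. a ^ m \<in> J"
  proof
    fix b assume "b \<in> J'"
    then obtain a x where b: "b = a + x * g" "a \<in> J" "x \<in> carrier P" unfolding J' by blast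
    have "nilp (x * g)" using nilp_mult b(3) g(2) unfolding nilp_def by blast
    moreover have "x * g - b \<in> J" using uminus_J[OF b(2)] by (simp add: b(1))
    ultimately have "nilp b"
      using nilp_cong b g(1) by (metis add_C J_imp_C mult_C)
    then show "\<exists>m. b ^ m \<in> J" unfolding nilp_def .
  qed
  have "mpoly_quot n J'"
  proof (rule mpoly_quot.intro)
    show "ideal J' P" unfolding J'_def
      using g(1) by (intro mpoly.add_ideals ideal_J mpoly.genideal_ideal) simp
    show "1 \<notin> J'" using rad one_J by (metis power_one)
  qed
  then show "zd_quot n J'"
    using finite_dim_mono[OF _ sub fin] by (simp add: zd_quot_def zd_quot_axioms_def)
qed

end

lemma zd_quot_if_zero_dimensional:
  assumes "zero_dimensional n I"
  shows "zd_quot n I"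
proof -
  have I: "ideal I (mpoly_ring n)" using assms unfolding zero_dimensional_def by blast
  have "1 \<notin> I"
  proof
    assume "1 \<in> I"
    then have "I = carrier (mpoly_ring n)" using ideal.one_imp_carrier[OF I] by simp
    then have "I +>\<^bsub>mpoly_ring n\<^esub> a = I +>\<^bsub>mpoly_ring n\<^esub> \<zero>\<^bsub>mpoly_ring n\<^esub>" if "a \<in> carrier (mpoly_ring n)" for a
      using mpoly.quotient_eq_iff_same_a_r_cos[OF I that mpoly.zero_closed] that
        mpoly.minus_closed[OF that mpoly.zero_closed] by blast
    moreover have "I +>\<^bsub>mpoly_ring n\<^esub> \<zero>\<^bsub>mpoly_ring n\<^esub> = I"
      using ideal.Icarr[OF I] by (intro mpoly.a_coset_add_zero subsetI)
    ultimately have "carrier (mpoly_ring n Quot I) = {\<zero>\<^bsub>mpoly_ring n Quot I\<^esub>}"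
      using mpoly.zero_closed[of n] unfolding FactRing_def A_RCOSETS_def' by auto
    then show False using assms unfolding zero_dimensional_def by blast
  qed
  then interpret mpoly_quot n I by (rule mpoly_quot.intro[OF I])
  have finite_dim using assms by (simp add: finite_dim_def zero_dimensional_def)
  then show ?thesis by (intro zd_quot.intro zd_quot_axioms.intro mpoly_quot_axioms)
qed

lemma (in zd_quot) primary_ideal_iff_local: "primary_ideal J P \<longleftrightarrow> is_local"
proof -
  have "primary_ideal J P \<longleftrightarrow> primary"
    using ideal_J one_C one_J unfolding primary_ideal_def primary_def
    by (auto simp: mpoly_ring_nat_pow)
  then show ?thesis using local_imp_primary primary_imp_local finite_dim_algebraic[OF fin] by blast
qed

text \<open>
  The ideal only grows within the radical of the initial one, so locality is invariant, and a
  polynomial relation once established for some \<open>x\<^sub>i\<close> persists in all later ideals.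
\<close>
lemma first_loop_sound:
  assumes "zd_quot n J" "set is \<subseteq> {1..n}"
  shows "case first_loop n is J (quot_dim n J) of
      Inl b \<Rightarrow> b \<longleftrightarrow> alg_quot.is_local (carrier (mpoly_ring n)) J
    | Inr (J', d) \<Rightarrow> zd_quot n J' \<and> J \<subseteq> J' \<and> (\<forall>a\<in>J'. \<exists>m::nat. a ^ m \<in> J) \<and> d = quot_dim n J' \<and>
        (\<forall>i\<in>set is. \<exists>p. irreducible p \<and> subst_poly p (mvar i) \<in> J')"
  using assms
proof (induction "is" arbitrary: J)
  case Nil
  then show ?case by (auto intro: exI[of _ 1])
next
  case (Cons i "is")
  interpret zd_quot n J by fact
  let ?x = "mvar i"
  define \<mu> where "\<mu> = min_poly n ?x J"
  have x: "?x \<in> carrier P" using Cons.prems(2) by (intro mvar_in_mpoly_ring) auto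
  have \<mu>: "minpoly \<mu> ?x" unfolding \<mu>_def using x by (rule ex_min_poly)
  note lc = minpoly_monic[OF \<mu>] and \<mu>J = minpoly_root[OF \<mu>]
  have deg: "degree \<mu> > 0" using \<mu> by (rule minpoly_degree_pos)
  define A where "A \<longleftrightarrow> (\<exists>p k. irreducible p \<and> p dvd \<mu> \<and> \<mu> = p ^ k)"
  define J1 where "J1 = J <+>\<^bsub>P\<^esub> Idl\<^bsub>P\<^esub> {subst_poly (sqfree \<mu>) ?x}"
  have eq: "first_loop n (i # is) J (quot_dim n J) =
     (if \<not> A then Inl False
      else if degree \<mu> = quot_dim n J then Inl True
      else if \<not> squarefree \<mu> then
        (if degree (sqfree \<mu>) = quot_dim n J1 then Inl True else first_loop n is J1 (quot_dim n J1))
      else first_loop n is J (quot_dim n J))"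
    unfolding first_loop.simps Let_def A_def \<mu>_def J1_def ..
  show ?case
  proof (cases A)
    case False
    have "\<not> is_local"
    proof
      assume loc: is_local
      obtain p k where p: "irreducible p" "k > 0" "\<mu> = p ^ k"
        using local_minpoly_prime_power[OF loc \<mu> x] by (elim exE conjE)
      then have "p dvd \<mu>" by simp
      then have A unfolding A_def using p by (intro exI[of _ p] exI[of _ k] conjI)
      then show False using False by simp
    qed
    then show ?thesis using False unfolding eq by simp
  next
    case True
    then obtain r j where r: "irreducible r" "lead_coeff r = 1" "j > 0" "\<mu> = r ^ j"
      using monic_prime_power[OF lc deg] unfolding A_def by metis
    have rJ: "ev r ?x ^ j \<in> J" using \<mu>J unfolding r(4) ev_power .
    show ?thesis
    proof (cases "degree \<mu> = quot_dim n J")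
      case d: True
      have is_local using local_if_degree_min_poly[OF x r(1) rJ] d unfolding \<mu>_def by blast
      then show ?thesis using True d unfolding eq by simp
    next
      case d: False
      show ?thesis
      proof (cases "squarefree \<mu>")
        case sq: True
        have "j = 1"
        proof (rule ccontr)
          assume "j \<noteq> 1"
          then have "r ^ 2 dvd \<mu>" unfolding r(4) using r(3) by (intro le_imp_power_dvd) simp
          then show False using sq squarefreeD irreducible_not_unit[OF r(1)] by blast
        qed
        then have irr: "irreducible \<mu>" using r by simp
        have step: "first_loop n (i # is) J (quot_dim n J) = first_loop n is J (quot_dim n J)"
          using True d sq unfolding eq by simp
        have "set is \<subseteq> {1..n}" using Cons.prems(2) by simp
        note IH = Cons.IH[OF Cons.prems(1) this]
        have "\<exists>p. irreducible p \<and> subst_poly p ?x \<in> J'" if "J \<subseteq> J'" for J'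
          using irr \<mu>J that unfolding ev_eq by blast
        then show ?thesis using IH unfolding step by (auto split: sum.splits)
      next
        case sq: False
        have sf: "sqfree \<mu> = r" unfolding r(4) using r by (intro sqfree_prime_power)
        note J1 = radical_extension[OF ev_C[OF x] rJ, unfolded ev_eq, folded J1_def[unfolded sf]]
        interpret J1: zd_quot n J1 by (rule J1(1))
        have loc: "J1.is_local \<longleftrightarrow> is_local"
          by (rule local_iff_radical[OF alg_quot_axioms J1.alg_quot_axioms J1(2,4)])
        have step: "first_loop n (i # is) J (quot_dim n J)
            = (if degree r = quot_dim n J1 then Inl True else first_loop n is J1 (quot_dim n J1))"
          using True d sq unfolding eq sf by simp
        show ?thesis
        proof (cases "degree r = quot_dim n J1")
          case dr: True
          \<comment> \<open>The irreducible \<open>r\<close> is still the minimal polynomial of \<open>x\<^sub>i\<close> modulo the enlarged ideal.\<close>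
          define \<nu> where "\<nu> = min_poly n ?x J1"
          have \<nu>: "J1.minpoly \<nu> ?x" unfolding \<nu>_def using x by (rule J1.ex_min_poly)
          have "\<nu> dvd r" using J1.minpoly_dvd_iff[OF \<nu>] J1(3) by (simp add: J1.ev_eq)
          have "\<not> is_unit \<nu>"
            using J1.minpoly_degree_pos[OF \<nu>] is_unit_iff_degree[of \<nu>] by (cases "\<nu> = 0") auto
          then have "r dvd \<nu>" using irreducibleD'[OF r(1) \<open>\<nu> dvd r\<close>] by simp
          then have "r = \<nu>" using \<open>\<nu> dvd r\<close> r(2) J1.minpoly_monic[OF \<nu>] by (intro monic_dvd_antisym)
          then have "J1.is_local"
            using J1.local_if_degree_min_poly[OF x r(1), of 1] dr J1(3) unfolding \<nu>_def J1.ev_eq by simp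
          then show ?thesis unfolding step using dr loc by simp
        next
          case dr: False
          have "set is \<subseteq> {1..n}" using Cons.prems(2) by simp
          note IH = Cons.IH[OF J1(1) this]
          have "\<exists>p. irreducible p \<and> subst_poly p ?x \<in> J'" if "J1 \<subseteq> J'" for J'
            using r(1) J1(3) that by blast
          moreover have "\<forall>a\<in>J'. \<exists>m::nat. a ^ m \<in> J" if "\<forall>a\<in>J'. \<exists>m::nat. a ^ m \<in> J1" for J'
            using that J1(4) by (metis power_mult)
          ultimately show ?thesis using IH J1(2) dr loc unfolding step
            by (auto split: sum.splits)
        qed
      qed
    qed
  qed
qed

text \<open>
  Only answers are considered, so induction over the unfoldings of the partial function applies. The
  last hypothesis is what the first loop contributes, by way of \<open>local_reduced_minpoly_irreducible\<close>.
\<close>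
lemma second_loop_sound:
  assumes "second_loop n J d l = Some b"
    and "zd_quot n J" "d = quot_dim n J" "\<forall>k. l k \<in> carrier (mpoly_ring n)"
    and "alg_quot.is_local (carrier (mpoly_ring n)) J \<Longrightarrow>
      \<forall>f\<in>carrier (mpoly_ring n). irreducible (min_poly n f J)"
  shows "b \<longleftrightarrow> alg_quot.is_local (carrier (mpoly_ring n)) J"
  using assms
proof (induction rule: second_loop.raw_induct[rotated, consumes 1])
  case (1 sl n J d l b)
  interpret zd_quot n J by fact
  define \<mu> where "\<mu> = min_poly n (l 0) J"
  have l: "l 0 \<in> carrier P" using 1 by blast
  have eq: "(if \<not> irreducible \<mu> then Some False else if degree \<mu> = d then Some True
      else sl n J d (\<lambda>k. l (Suc k))) = Some b"
    using 1(2) unfolding Let_def \<mu>_def .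
  show ?case
  proof (cases "irreducible \<mu>")
    case False
    then show ?thesis using eq 1(6) l unfolding \<mu>_def by auto
  next
    case irr: True
    show ?thesis
    proof (cases "degree \<mu> = d")
      case True
      have "ev \<mu> (l 0) ^ 1 \<in> J" using minpoly_root[OF ex_min_poly[OF l]] unfolding \<mu>_def by simp
      then have is_local
        using local_if_degree_min_poly[OF l irr] True 1(4) unfolding \<mu>_def by blast
      then show ?thesis using eq irr True by simp
    next
      case False
      then have "sl n J d (\<lambda>k. l (Suc k)) = Some b" using eq irr by simp
      then show ?thesis using 1 by blast
    qed
  qed
qed

theorem mainTheorem8:
  fixes n :: nat and I :: "'k::field mpoly set"
  assumes "perfect_field TYPE('k)"
    and "zero_dimensional n I"
  shows "(\<forall>l. (\<forall>k. linear_form n (l k)) \<longrightarrow>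
            (\<forall>b. primary_test n I l = Some b \<longrightarrow> (b \<longleftrightarrow> primary_ideal I (mpoly_ring n)))) \<and>
         (finite (UNIV :: 'k set) \<longrightarrow>
            (\<forall>l. (\<forall>k. linear_form n (l k)) \<longrightarrow> primary_test n I l \<noteq> None))"
proof (intro conjI allI impI)
  interpret zd_quot n I by (rule zd_quot_if_zero_dimensional) fact
  fix l b assume l: "\<forall>k. linear_form n (l k)" and b: "primary_test n I l = Some b"
  have set: "set [1..<Suc n] = {1..n}" by auto
  note loop = first_loop_sound[OF zd_quot_axioms, of "[1..<Suc n]", unfolded set, OF subset_refl]
  have "b \<longleftrightarrow> is_local"
  proof (cases "first_loop n [1..<Suc n] I (quot_dim n I)")
    case (Inl b')
    then show ?thesis using loop b unfolding primary_test_def Inl by simp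
  next
    case (Inr Jd)
    obtain J d where Jd: "Jd = (J, d)" by (cases Jd)
    have J: "zd_quot n J" "I \<subseteq> J" "\<forall>a\<in>J. \<exists>m::nat. a ^ m \<in> I" "d = quot_dim n J"
        and vars: "\<And>i. i \<in> {1..n} \<Longrightarrow> \<exists>p. irreducible p \<and> subst_poly p (mvar i) \<in> J"
      using loop unfolding Inr Jd by auto
    show ?thesis
    proof (cases "finite (UNIV :: 'k set)")
      case True
      then show ?thesis
        using b frobenius_dim_eq_1_iff[OF fin True]
        unfolding primary_test_def Inr Jd Let_def by simp
    next
      case False
      interpret J: zd_quot n J by (rule J(1))
      have loc: "J.is_local \<longleftrightarrow> is_local"
        by (rule local_iff_radical[OF alg_quot_axioms J.alg_quot_axioms J(2,3)])
      have irr: "irreducible (min_poly n f J)" if "J.is_local" "f \<in> carrier P" for f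
      proof (rule J.local_reduced_minpoly_irreducible[OF that(1) _ J.ex_min_poly[OF that(2)] that(2)])
        show "a \<in> J" if a: "a \<in> carrier P" "J.nilp a" for a
          by (rule J.separable_variables_reduced[OF assms(1) J.finite_dim_algebraic[OF J.fin]
                \<open>J.is_local\<close> _ a]) (use vars J.ev_eq in simp)
      qed
      have "second_loop n J d l = Some b"
        using b False unfolding primary_test_def Inr Jd by simp
      then have "b \<longleftrightarrow> J.is_local"
        by (rule second_loop_sound[OF _ J(1,4)]) (use l linear_form_in_mpoly_ring irr in blast)+
      then show ?thesis using loc by simp
    qed
  qed
  then show "b \<longleftrightarrow> primary_ideal I (mpoly_ring n)" by (simp add: primary_ideal_iff_local)
next
  fix l :: "nat \<Rightarrow> 'k mpoly"
  assume "finite (UNIV :: 'k set)"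
  then show "primary_test n I l \<noteq> None"
    by (simp add: primary_test_def Let_def split: sum.splits prod.splits)
qed

end
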